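(* Let $f:(\mathbb{R}^2,0)\to(\mathbb{R}^3,0)$ be a $C^\infty$ map-germ. Assume there is a local coordinate system $(u,v)$ centred at $0$ and smooth $\mathbb{R}^3$-valued germs $\phi_1,\phi_2$ such that $f_u=u\,\phi_1(u,v)$, $f_v=v\,\phi_2(u,v)$, and $\phi_1(0,0),\phi_2(0,0)$ are linearly independent. Then there exist a real number $a$, smooth function germs $b_1,b_3,c_1,c_3$ of one variable at $0$, smooth function germs $b_2,c_2$ of two variables at $0$, a germ $s$ of an orientation-preserving diffeomorphism of $(\mathbb{R}^2,0)$ and $A\in SO(3)$ such that $$A\circ f\circ s^{-1}(u,v)=\Big(u^2-v^2,\ a(u^2+v^2)+u^3b_1(u)+u^2v^2b_2(u,v)+v^3b_3(v),\ u^3c_1(u)+u^2v^2c_2(u,v)+v^3c_3(v)\Big),$$ with $a\ge 0$, $c_1(0)\ge 0$ and $c_3(0)\ge 0$.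
   Context: A map-germ $(\mathbb{R}^n,0)\to(\mathbb{R}^m,0)$ means a germ at $0$ of a smooth map sending $0$ to $0$. $SO(3)$ acts on $\mathbb{R}^3$ by rotations. *)

theory Defs
  imports "HOL-Analysis.Analysis"
begin

fun iter_partial :: "'a::euclidean_space list \<Rightarrow> ('a \<Rightarrow> 'b::real_normed_vector) \<Rightarrow> 'a \<Rightarrow> 'b" where
  "iter_partial [] g = g"
| "iter_partial (d # ds) g = (\<lambda>x. frechet_derivative (iter_partial ds g) (at x) d)"

text \<open>C-infinity on a set U (meant for open U): all iterated partial derivatives
  exist and are differentiable (hence continuous) at every point of U.\<close>
definition smooth_on :: "'a::euclidean_space set \<Rightarrow> ('a \<Rightarrow> 'b::real_normed_vector) \<Rightarrow> bool" where
  "smooth_on U g \<longleftrightarrow> (\<forall>ds. set ds \<subseteq> Basis \<longrightarrow> (\<forall>x\<in>U. iter_partial ds g differentiable (at x)))"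

definition smooth_germ0 :: "('a::euclidean_space \<Rightarrow> 'b::real_normed_vector) \<Rightarrow> bool" where
  "smooth_germ0 g \<longleftrightarrow> (\<exists>U. open U \<and> 0 \<in> U \<and> smooth_on U g)"

text \<open>s : U \<rightarrow> V is a diffeomorphism between open neighbourhoods of 0 with inverse t,
  fixing 0 (a representative of a diffeomorphism germ of (R^2,0)).\<close>
definition diffeo0 :: "(real \<times> real) set \<Rightarrow> (real \<times> real) set \<Rightarrow>
    (real \<times> real \<Rightarrow> real \<times> real) \<Rightarrow> (real \<times> real \<Rightarrow> real \<times> real) \<Rightarrow> bool" where
  "diffeo0 U V s t \<longleftrightarrow> open U \<and> open V \<and> 0 \<in> U \<and> s 0 = 0 \<and> s ` U = V \<and> t ` V = U \<and>
     (\<forall>x\<in>U. t (s x) = x) \<and> (\<forall>y\<in>V. s (t y) = y) \<and> smooth_on U s \<and> smooth_on V t"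

definition jac_det :: "(real \<times> real \<Rightarrow> real \<times> real) \<Rightarrow> real \<times> real \<Rightarrow> real" where
  "jac_det s p = (let D = frechet_derivative s (at p) in
      fst (D (1,0)) * snd (D (0,1)) - snd (D (1,0)) * fst (D (0,1)))"

definition partial_u :: "(real \<times> real \<Rightarrow> 'b::real_normed_vector) \<Rightarrow> real \<times> real \<Rightarrow> 'b" where
  "partial_u g p = frechet_derivative g (at p) (1,0)"

definition partial_v :: "(real \<times> real \<Rightarrow> 'b::real_normed_vector) \<Rightarrow> real \<times> real \<Rightarrow> 'b" where
  "partial_v g p = frechet_derivative g (at p) (0,1)"

definition SO3 :: "(real^3^3) set" where
  "SO3 = {A. orthogonal_matrix A \<and> det A = 1}"

end

theory Submission
  imports Defs
begin

text \<open>In the given coordinates \<open>g = f \<circ> \<kappa>\<^sup>-\<^sup>1\<close> satisfies \<open>g\<^sub>u = 0\<close> on \<open>u = 0\<close> and \<open>g\<^sub>v = 0\<close> on \<open>v = 0\<close>.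
  By Hadamard's lemma a function with this property that vanishes at the origin is of the form
  \<open>u\<^sup>2 p(u) + v\<^sup>2 q(v) + u\<^sup>2 v\<^sup>2 r(u,v)\<close>.
  The bisectors of the directions of \<open>\<phi>\<^sub>1(0)\<close> and \<open>\<phi>\<^sub>2(0)\<close> are orthogonal, so some rotation sends these
  vectors to \<open>\<alpha>(1, a, 0)\<close> and \<open>\<beta>(-1, a, 0)\<close> with \<open>\<alpha>, \<beta>, a > 0\<close>.
  If \<open>u\<^sup>2 p + v\<^sup>2 q + u\<^sup>2 v\<^sup>2 r\<close> is the first component after this rotation, the new coordinates
  \<open>(u sqrt (p + v\<^sup>2 r), v sqrt (- q))\<close> turn it into \<open>u\<^sup>2 - v\<^sup>2\<close>. They preserve the criticality along both
  axes, so the decomposition applies again to the other two components.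
  Finally the signs of \<open>c\<^sub>1(0)\<close> and \<open>c\<^sub>3(0)\<close> are adjusted by reflections in the axes, and the
  orientation by exchanging the coordinates and applying a half-turn in the target.\<close>

section \<open>Calculus of smooth functions\<close>

text \<open>The hypothesis enters in two ways. The vanishing of each partial derivative along its
  axis excludes every monomial of degree exactly one in u or in v, so mixed terms start at
  \<open>u^2 v^2\<close>; this property passes to the new coordinates, whereas the factorisation
  through \<phi>1 and \<phi>2 is not tracked through them. The values \<phi>1(0) and \<phi>2(0) are
  twice the quadratic coefficients. After the rotation these coefficients are (\<alpha>/2, a
  \<alpha>/2, 0) in u and (-\<beta>/2, a \<beta>/2, 0) in v. Normalising the first component divides
  them by \<alpha>/2 and \<beta>/2 respectively, which leaves the same \<open>a\<close> in both
  variables and 0 in the third component. This is what the choice of the bisectors as axes achieves.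
  The term with \<open>r\<close> is put entirely under the first root. The second new coordinate
  then depends on v alone, so the Jacobian matrix is triangular and the chain rule can be solved for
  the new partial derivatives.\<close>

text \<open>Where \<open>iter_partial\<close> adds a new derivative on the outside, \<open>ck_on\<close> differentiates the function
  itself first; closure properties then go by induction on the order.\<close>

fun ck_on :: "nat \<Rightarrow> 'a::euclidean_space set \<Rightarrow> ('a \<Rightarrow> 'b::real_normed_vector) \<Rightarrow> bool" where
  "ck_on 0 U g \<longleftrightarrow> (\<forall>x\<in>U. g differentiable (at x))"
| "ck_on (Suc k) U g \<longleftrightarrow> (\<forall>x\<in>U. g differentiable (at x)) \<and>
     (\<forall>d\<in>Basis. ck_on k U (\<lambda>x. frechet_derivative g (at x) d))"

lemma iter_partial_snoc:
  "iter_partial (ds @ [d]) g = iter_partial ds (\<lambda>x. frechet_derivative g (at x) d)"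
  by (induction ds) auto

lemma ck_on_iff_iter_partial:
  "ck_on k U g \<longleftrightarrow>
    (\<forall>ds. length ds \<le> k \<longrightarrow> set ds \<subseteq> Basis \<longrightarrow> (\<forall>x\<in>U. iter_partial ds g differentiable (at x)))"
proof (induction k arbitrary: g)
  case 0
  then show ?case by auto
next
  case (Suc k)
  show ?case (is "?L \<longleftrightarrow> ?R")
  proof
    assume L: ?L
    show ?R
    proof (intro allI impI)
      fix ds :: "'a list"
      assume "length ds \<le> Suc k" "set ds \<subseteq> Basis"
      then show "\<forall>x\<in>U. iter_partial ds g differentiable (at x)"
      \<comment> \<open>The last entry of the list is the derivative taken first, so the list is
        split from the right.\<close>
      proof (cases ds rule: rev_cases)
        case (snoc es d)
        then show ?thesis
          using L \<open>length ds \<le> Suc k\<close> \<open>set ds \<subseteq> Basis\<close> Suc.IH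
          by (simp add: iter_partial_snoc)
      qed (use L in auto)
    qed
  next
    assume R: ?R
    have "ck_on k U (\<lambda>x. frechet_derivative g (at x) d)" if "d \<in> Basis" for d
      unfolding Suc.IH
    proof (intro allI impI)
      fix ds :: "'a list"
      assume "length ds \<le> k" "set ds \<subseteq> Basis"
      then show "\<forall>x\<in>U. iter_partial ds (\<lambda>x. frechet_derivative g (at x) d) differentiable (at x)"
        using R[rule_format, of "ds @ [d]"] that by (auto simp: iter_partial_snoc)
    qed
    moreover have "\<forall>x\<in>U. g differentiable (at x)"
      using R[rule_format, of "[]"] by simp
    ultimately show ?L by simp
  qed
qed

lemma smooth_on_iff_ck_on: "smooth_on U g \<longleftrightarrow> (\<forall>k. ck_on k U g)"
  unfolding smooth_on_def ck_on_iff_iter_partial by auto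

lemma smooth_on_differentiable: "smooth_on U g \<Longrightarrow> x \<in> U \<Longrightarrow> g differentiable (at x)"
  unfolding smooth_on_iff_ck_on by (metis ck_on.simps(1))

lemma smooth_on_frechet_derivative:
  "smooth_on U g \<Longrightarrow> d \<in> Basis \<Longrightarrow> smooth_on U (\<lambda>x. frechet_derivative g (at x) d)"
  unfolding smooth_on_iff_ck_on by (metis ck_on.simps(2))

lemma smooth_on_continuous: "smooth_on U g \<Longrightarrow> continuous_on U g"
  by (meson continuous_at_imp_continuous_on differentiable_imp_continuous_within smooth_on_differentiable)

lemma smooth_on_subset: "smooth_on U g \<Longrightarrow> V \<subseteq> U \<Longrightarrow> smooth_on V g"
  unfolding smooth_on_def by blast

lemma ck_on_differentiable: "ck_on k U g \<Longrightarrow> x \<in> U \<Longrightarrow> g differentiable (at x)"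
  by (cases k) auto

lemma ck_on_Suc_D: "ck_on (Suc k) U g \<Longrightarrow> ck_on k U g"
  unfolding ck_on_iff_iter_partial by auto

lemma ck_on_Suc_I:
  assumes "\<And>x. x \<in> U \<Longrightarrow> (g has_derivative g' x) (at x)"
    and "\<And>d. d \<in> Basis \<Longrightarrow> ck_on k U (\<lambda>x. frechet_derivative g (at x) d)"
  shows "ck_on (Suc k) U g"
  using assms by (auto simp: differentiable_def)

lemma ck_on_cong:
  assumes "open U" "ck_on k U g" "\<And>x. x \<in> U \<Longrightarrow> g x = h x"
  shows "ck_on k U h"
  using assms(2,3)
proof (induction k arbitrary: g h)
  have diff: "h differentiable (at x) \<and> frechet_derivative h (at x) = frechet_derivative g (at x)"
    if "g differentiable (at x)" "\<And>x. x \<in> U \<Longrightarrow> g x = h x" "x \<in> U" for g h :: "'a \<Rightarrow> 'b" and x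
  proof -
    have "(g has_derivative frechet_derivative g (at x)) (at x)"
      using that(1) frechet_derivative_works by blast
    then have "(h has_derivative frechet_derivative g (at x)) (at x)"
      by (rule has_derivative_transform_within_open[OF _ assms(1) that(3)]) (use that in auto)
    then show ?thesis
      by (metis differentiableI frechet_derivative_at)
  qed
  {
    case 0
    then show ?case using diff[of g _ h] by auto
  next
    case (Suc k)
    have "ck_on k U (\<lambda>x. frechet_derivative h (at x) d)" if "d \<in> Basis" for d
      by (rule Suc.IH[of "\<lambda>x. frechet_derivative g (at x) d"])
        (use Suc.prems that diff[of g _ h] in auto)
    then show ?case using Suc.prems diff[of g _ h] by auto
  }
qed

text \<open>The working form of the induction step. Openness lets \<open>frechet_derivative\<close>
  be replaced by an explicit formula, so a closure property reduces to a differentiation rule and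
  the induction hypothesis.\<close>

lemma ck_on_Suc_has_derivative:
  assumes "open U" "\<And>x. x \<in> U \<Longrightarrow> (g has_derivative g' x) (at x)"
    and "\<And>d. d \<in> Basis \<Longrightarrow> ck_on k U (\<lambda>x. g' x d)"
  shows "ck_on (Suc k) U g"
proof (rule ck_on_Suc_I)
  fix d :: 'a
  assume "d \<in> Basis"
  then have "ck_on k U (\<lambda>x. g' x d)" by (rule assms)
  then show "ck_on k U (\<lambda>x. frechet_derivative g (at x) d)"
    by (rule ck_on_cong[OF assms(1)]) (metis assms(2) frechet_derivative_at)
qed (use assms in auto)

lemma ck_on_0_has_derivative:
  assumes "\<And>x. x \<in> U \<Longrightarrow> (g has_derivative g' x) (at x)"
  shows "ck_on 0 U g"
  using assms by (auto simp: differentiable_def)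

lemma differentiable_has_frechet_derivative:
  "g differentiable (at x) \<Longrightarrow> (g has_derivative frechet_derivative g (at x)) (at x)"
  using frechet_derivative_works by blast

lemma ck_on_has_derivative:
  "ck_on k U g \<Longrightarrow> x \<in> U \<Longrightarrow> (g has_derivative frechet_derivative g (at x)) (at x)"
  by (meson ck_on_differentiable frechet_derivative_works)

lemma smooth_on_has_derivative:
  "smooth_on U g \<Longrightarrow> x \<in> U \<Longrightarrow> (g has_derivative frechet_derivative g (at x)) (at x)"
  by (meson smooth_on_differentiable frechet_derivative_works)

section \<open>Closure properties of smooth functions\<close>

lemma smooth_on_const: "open U \<Longrightarrow> smooth_on U (\<lambda>x. c)"
proof -
  assume "open U"
  have "ck_on k U (\<lambda>x. c)" for k
    by (induction k arbitrary: c) (auto simp: frechet_derivative_const)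
  then show ?thesis unfolding smooth_on_iff_ck_on by blast
qed

lemma ck_on_bounded_linear_compose:
  assumes "open U" "bounded_linear L" "ck_on k U g"
  shows "ck_on k U (\<lambda>x. L (g x))"
  using assms(3)
proof (induction k arbitrary: g)
  case 0
  show ?case
    by (rule ck_on_0_has_derivative[OF bounded_linear.has_derivative[OF assms(2) ck_on_has_derivative[OF 0]]])
next
  case (Suc k)
  show ?case
  proof (rule ck_on_Suc_has_derivative[OF assms(1)])
    show "((\<lambda>x. L (g x)) has_derivative (\<lambda>d. L (frechet_derivative g (at x) d))) (at x)" if "x \<in> U" for x
      by (rule bounded_linear.has_derivative[OF assms(2) ck_on_has_derivative[OF Suc.prems that]])
  qed (use Suc in auto)
qed

lemma ck_on_add:
  assumes "open U" "ck_on k U g" "ck_on k U h"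
  shows "ck_on k U (\<lambda>x. g x + h x)"
  using assms(2,3)
proof (induction k arbitrary: g h)
  case 0
  show ?case
    by (rule ck_on_0_has_derivative[OF has_derivative_add[OF ck_on_has_derivative[OF 0(1)] ck_on_has_derivative[OF 0(2)]]])
next
  case (Suc k)
  show ?case
    by (rule ck_on_Suc_has_derivative[OF assms(1) has_derivative_add[OF
        ck_on_has_derivative[OF Suc.prems(1)] ck_on_has_derivative[OF Suc.prems(2)]]])
      (use Suc in auto)
qed

lemma ck_on_scaleR:
  fixes r :: "'a::euclidean_space \<Rightarrow> real"
  assumes "open U" "ck_on k U r" "ck_on k U g"
  shows "ck_on k U (\<lambda>x. r x *\<^sub>R g x)"
  using assms(2,3)
proof (induction k arbitrary: r g)
  case 0
  show ?case
    by (rule ck_on_0_has_derivative[OF has_derivative_scaleR[OF ck_on_has_derivative[OF 0(1)] ck_on_has_derivative[OF 0(2)]]])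
next
  case (Suc k)
  \<comment> \<open>The product rule retains one undifferentiated factor in each summand; it is
    needed at order \<open>k\<close> only.\<close>
  note [simp] = ck_on_Suc_D[OF Suc.prems(1)] ck_on_Suc_D[OF Suc.prems(2)]
  show ?case
    by (rule ck_on_Suc_has_derivative[OF assms(1) has_derivative_scaleR[OF
        ck_on_has_derivative[OF Suc.prems(1)] ck_on_has_derivative[OF Suc.prems(2)]]])
      (use Suc.prems in \<open>auto intro!: ck_on_add assms(1) Suc.IH\<close>)
qed

lemma ck_on_sum:
  fixes g :: "'i \<Rightarrow> 'a::euclidean_space \<Rightarrow> 'b::real_normed_vector"
  assumes "open U" "finite I" "\<And>i. i \<in> I \<Longrightarrow> ck_on k U (g i)"
  shows "ck_on k U (\<lambda>x. \<Sum>i\<in>I. g i x)"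
  using assms(2,3)
proof (induction I rule: finite_induct)
  case empty
  show ?case using smooth_on_const[OF assms(1), of "0::'b"] by (simp add: smooth_on_iff_ck_on)
next
  case (insert i I)
  then show ?case by (simp add: ck_on_add[OF assms(1)])
qed

text \<open>The chain rule, expanded in the basis, writes the derivative as a sum of components of
  the derivative of \<open>h\<close> times partial derivatives of \<open>g\<close> taken at
  \<open>h x\<close>. The latter are again compositions with \<open>h\<close>, hence the induction
  over all \<open>g\<close> with \<open>h\<close> fixed.\<close>

lemma ck_on_compose:
  fixes h :: "'a::euclidean_space \<Rightarrow> 'b::euclidean_space" and g :: "'b \<Rightarrow> 'c::real_normed_vector"
  assumes "open U" "ck_on k U h" "ck_on k V g" "\<And>x. x \<in> U \<Longrightarrow> h x \<in> V"
  shows "ck_on k U (\<lambda>x. g (h x))"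
  using assms(2,3)
proof (induction k arbitrary: g)
  case 0
  show ?case
    by (rule ck_on_0_has_derivative[OF has_derivative_compose[OF ck_on_has_derivative[OF 0(1)]
       ck_on_has_derivative[OF 0(2) assms(4)]]])
next
  case (Suc k)
  define g' where "g' x d = (\<Sum>e\<in>Basis. (frechet_derivative h (at x) d \<bullet> e) *\<^sub>R frechet_derivative g (at (h x)) e)" for x d
  have hk: "ck_on k U h" using Suc.prems(1) by (rule ck_on_Suc_D)
  show ?case
  proof (rule ck_on_Suc_has_derivative[OF assms(1)])
    fix x assume x: "x \<in> U"
    have gd: "(g has_derivative frechet_derivative g (at (h x))) (at (h x))"
      by (rule ck_on_has_derivative[OF Suc.prems(2) assms(4)[OF x]])
    have "frechet_derivative g (at (h x)) y = (\<Sum>e\<in>Basis. (y \<bullet> e) *\<^sub>R frechet_derivative g (at (h x)) e)" for y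
    proof -
      interpret bounded_linear "frechet_derivative g (at (h x))"
        using gd by (rule has_derivative_bounded_linear)
      show ?thesis
        by (subst euclidean_representation[of y, symmetric]) (simp only: sum scaleR)
    qed
    then have "g' x = (\<lambda>d. frechet_derivative g (at (h x)) (frechet_derivative h (at x) d))"
      unfolding g'_def by metis
    then show "((\<lambda>x. g (h x)) has_derivative g' x) (at x)"
      using has_derivative_compose[OF ck_on_has_derivative[OF Suc.prems(1) x] gd] by simp
  next
    fix d :: 'a assume d: "d \<in> Basis"
    have "ck_on k U (\<lambda>x. frechet_derivative g (at (h x)) e)" if "e \<in> Basis" for e
      by (rule Suc.IH[OF hk]) (use Suc.prems(2) that in auto)
    moreover have "ck_on k U (\<lambda>x. frechet_derivative h (at x) d \<bullet> e)" for e
      by (rule ck_on_bounded_linear_compose[OF assms(1) bounded_linear_inner_left]) (use Suc.prems(1) d in auto)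
    ultimately show "ck_on k U (\<lambda>x. g' x d)"
      unfolding g'_def by (intro ck_on_sum ck_on_scaleR assms(1)) auto
  qed
qed

lemma smooth_on_compose:
  fixes h :: "'a::euclidean_space \<Rightarrow> 'b::euclidean_space" and g :: "'b \<Rightarrow> 'c::real_normed_vector"
  assumes "open U" "smooth_on U h" "smooth_on V g" "\<And>x. x \<in> U \<Longrightarrow> h x \<in> V"
  shows "smooth_on U (\<lambda>x. g (h x))"
  using ck_on_compose[of U _ h V g] assms by (simp add: smooth_on_iff_ck_on)

lemma smooth_on_bounded_linear_compose:
  assumes "open U" "bounded_linear L" "smooth_on U g"
  shows "smooth_on U (\<lambda>x. L (g x))"
  using ck_on_bounded_linear_compose[OF assms(1,2)] assms(3) by (simp add: smooth_on_iff_ck_on)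

lemma smooth_on_ident: "open U \<Longrightarrow> smooth_on U (\<lambda>x. x)"
proof -
  assume U: "open U"
  have "ck_on k U (\<lambda>x. x)" for k
    using smooth_on_const[OF U] by (cases k) (auto simp: smooth_on_iff_ck_on)
  then show ?thesis unfolding smooth_on_iff_ck_on by blast
qed

lemma smooth_on_bounded_linear:
  "open U \<Longrightarrow> bounded_linear L \<Longrightarrow> smooth_on U L"
  using smooth_on_bounded_linear_compose[OF _ _ smooth_on_ident, of U L] by simp

lemma smooth_on_add:
  "open U \<Longrightarrow> smooth_on U g \<Longrightarrow> smooth_on U h \<Longrightarrow> smooth_on U (\<lambda>x. g x + h x)"
  by (simp add: smooth_on_iff_ck_on ck_on_add)

lemma smooth_on_minus:
  "open U \<Longrightarrow> smooth_on U g \<Longrightarrow> smooth_on U (\<lambda>x. - g x)"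
  by (rule smooth_on_bounded_linear_compose[OF _ bounded_linear_minus[OF bounded_linear_ident]])

lemma smooth_on_diff:
  "open U \<Longrightarrow> smooth_on U g \<Longrightarrow> smooth_on U h \<Longrightarrow> smooth_on U (\<lambda>x. g x - h x)"
  using smooth_on_add[OF _ _ smooth_on_minus, of U g h] by simp

lemma smooth_on_mult:
  fixes g h :: "'a::euclidean_space \<Rightarrow> real"
  shows "open U \<Longrightarrow> smooth_on U g \<Longrightarrow> smooth_on U h \<Longrightarrow> smooth_on U (\<lambda>x. g x * h x)"
  using ck_on_scaleR[of U _ g h] unfolding smooth_on_iff_ck_on by simp

lemma smooth_on_power:
  fixes g :: "'a::euclidean_space \<Rightarrow> real"
  shows "open U \<Longrightarrow> smooth_on U g \<Longrightarrow> smooth_on U (\<lambda>x. g x ^ n)"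
  by (induction n) (simp_all add: smooth_on_const smooth_on_mult)

lemma smooth_on_Pair:
  fixes g :: "'a::euclidean_space \<Rightarrow> 'b::euclidean_space" and h :: "'a \<Rightarrow> 'c::euclidean_space"
  assumes "open U" "smooth_on U g" "smooth_on U h"
  shows "smooth_on U (\<lambda>x. (g x, h x))"
proof -
  have "smooth_on U (\<lambda>x. (g x, 0) + (0, h x))"
    by (intro smooth_on_add assms smooth_on_bounded_linear_compose[of U "\<lambda>x. (x, 0)" g]
        smooth_on_bounded_linear_compose[of U "\<lambda>x. (0, x)" h]
        bounded_linear_Pair bounded_linear_ident bounded_linear_zero)
  then show ?thesis by simp
qed

lemma smooth_on_fst: "open U \<Longrightarrow> smooth_on U g \<Longrightarrow> smooth_on U (\<lambda>x. fst (g x))"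
  by (rule smooth_on_bounded_linear_compose[OF _ bounded_linear_fst])

lemma smooth_on_snd: "open U \<Longrightarrow> smooth_on U g \<Longrightarrow> smooth_on U (\<lambda>x. snd (g x))"
  by (rule smooth_on_bounded_linear_compose[OF _ bounded_linear_snd])

text \<open>The derivative is a polynomial in the function itself, so each order follows from the
  previous one.\<close>

lemma smooth_on_inverse_real: "smooth_on (- {0}) (inverse :: real \<Rightarrow> real)"
proof -
  have U: "open (- {0::real})" by auto
  have der: "(inverse has_derivative (\<lambda>d. - (inverse x * d * inverse x))) (at x)"
    if "x \<in> - {0}" for x :: real
    using that by (intro has_derivative_inverse') auto
  have "ck_on k (- {0}) (inverse :: real \<Rightarrow> real)" for k
  proof (induction k)
    case 0
    show ?case by (rule ck_on_0_has_derivative[OF der])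
  next
    case (Suc k)
    show ?case
    proof (rule ck_on_Suc_has_derivative[OF U der])
      fix d :: real assume "d \<in> Basis"
      then have "d = 1" by simp
      moreover have "ck_on k (- {0}) (\<lambda>x::real. - (inverse x *\<^sub>R inverse x))"
        by (intro ck_on_bounded_linear_compose[OF U bounded_linear_minus[OF bounded_linear_ident]]
            ck_on_scaleR U Suc.IH)
      ultimately show "ck_on k (- {0}) (\<lambda>x. - (inverse x * d * inverse x))" by simp
    qed
  qed
  then show ?thesis unfolding smooth_on_iff_ck_on by blast
qed

lemma smooth_on_sqrt_real: "smooth_on {0<..} sqrt"
proof -
  have U: "open {0::real<..}" by auto
  \<comment> \<open>The derivative is written through \<open>sqrt\<close> and
    \<open>inverse\<close>, not as the reciprocal of a root, so that the induction meets only
    \<open>sqrt\<close> itself and a function already known to be smooth.\<close>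
  have der: "(sqrt has_derivative (\<lambda>d. d * (sqrt x * inverse x / 2))) (at x)" if "x \<in> {0<..}" for x
  proof -
    have "sqrt x * inverse x / 2 = inverse (sqrt x) / 2"
      using that by (simp add: field_simps)
    then show ?thesis
      using that has_field_derivative_imp_has_derivative[OF DERIV_real_sqrt[of x]]
      by (simp only: mult_commute_abs) simp
  qed
  have "ck_on k {0<..} sqrt" for k
  proof (induction k)
    case 0
    show ?case by (rule ck_on_0_has_derivative[OF der])
  next
    case (Suc k)
    show ?case
    proof (rule ck_on_Suc_has_derivative[OF U der])
      fix d :: real assume "d \<in> Basis"
      then have "d = 1" by simp
      have "ck_on k {0::real<..} inverse"
        using smooth_on_subset[OF smooth_on_inverse_real, of "{0<..}"]
        by (auto simp: smooth_on_iff_ck_on)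
      then have "ck_on k {0<..} (\<lambda>x::real. (sqrt x *\<^sub>R inverse x) / 2)"
        by (intro ck_on_bounded_linear_compose[OF U bounded_linear_divide] ck_on_scaleR U Suc.IH)
      then show "ck_on k {0<..} (\<lambda>x. d * (sqrt x * inverse x / 2))"
        using \<open>d = 1\<close> by simp
    qed
  qed
  then show ?thesis unfolding smooth_on_iff_ck_on by blast
qed

lemma smooth_on_inverse:
  fixes g :: "'a::euclidean_space \<Rightarrow> real"
  assumes "open U" "smooth_on U g" "\<And>x. x \<in> U \<Longrightarrow> g x \<noteq> 0"
  shows "smooth_on U (\<lambda>x. inverse (g x))"
  by (rule smooth_on_compose[OF assms(1,2) smooth_on_inverse_real]) (use assms in auto)

lemma smooth_on_sqrt:
  assumes "open U" "smooth_on U g" "\<And>x. x \<in> U \<Longrightarrow> g x > 0"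
  shows "smooth_on U (\<lambda>x. sqrt (g x))"
  by (rule smooth_on_compose[OF assms(1,2) smooth_on_sqrt_real]) (use assms in auto)

section \<open>Hadamard's lemma in the plane\<close>

text \<open>A box is stable under shrinking one coordinate and under exchanging the two, and both
  its projections are one interval, which serves as the domain of all one-variable
  coefficients.\<close>

definition square :: "real \<Rightarrow> (real \<times> real) set" where
  "square e = {-e<..<e} \<times> {-e<..<e}"

lemma open_square: "open (square e)"
  unfolding square_def by (intro open_Times) auto

lemma convex_square: "convex (square e)"
  unfolding square_def by (intro convex_Times) auto

lemma in_square_iff: "(u, v) \<in> square e \<longleftrightarrow> \<bar>u\<bar> < e \<and> \<bar>v\<bar> < e"
  unfolding square_def by auto

lemma open_contains_square:
  assumes "open U" "0 \<in> U"
  obtains e where "e > 0" "square e \<subseteq> U"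
proof -
  obtain d where d: "d > 0" "ball 0 d \<subseteq> U"
    using assms open_contains_ball by blast
  have "square (d/2) \<subseteq> ball 0 d"
  proof
    fix x :: "real \<times> real"
    assume "x \<in> square (d/2)"
    then have "\<bar>fst x\<bar> < d/2" "\<bar>snd x\<bar> < d/2" by (auto simp: square_def)
    then have "norm x < d" using norm_Pair_le[of "fst x" "snd x"] by simp
    then show "x \<in> ball 0 d" by simp
  qed
  then show thesis using that[of "d/2"] d by auto
qed

section \<open>Partial derivatives in the plane\<close>

lemma partial_u_vector_derivative:
  assumes "g differentiable (at (u, v))"
  shows "((\<lambda>x. g (x, v)) has_vector_derivative partial_u g (u, v)) (at u)"
proof -
  have g: "(g has_derivative frechet_derivative g (at (u, v))) (at (u, v))"
    using assms frechet_derivative_works by blast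
  have "((\<lambda>x. (x, v)) has_derivative (\<lambda>d. (d, 0))) (at u)"
    by (intro derivative_eq_intros) auto
  from has_derivative_compose[OF this g]
  have "((\<lambda>x. g (x, v)) has_derivative (\<lambda>d. frechet_derivative g (at (u, v)) (d, 0))) (at u)" .
  moreover have "frechet_derivative g (at (u, v)) (d, 0) = d *\<^sub>R partial_u g (u, v)" for d
    using linear_cmul[OF has_derivative_linear[OF g], of d "(1,0)"] by (simp add: partial_u_def)
  ultimately show ?thesis by (simp add: has_vector_derivative_def)
qed

lemma partial_v_vector_derivative:
  assumes "g differentiable (at (u, v))"
  shows "((\<lambda>y. g (u, y)) has_vector_derivative partial_v g (u, v)) (at v)"
proof -
  have g: "(g has_derivative frechet_derivative g (at (u, v))) (at (u, v))"
    using assms frechet_derivative_works by blast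
  have "((\<lambda>y. (u, y)) has_derivative (\<lambda>d. (0, d))) (at v)"
    by (intro derivative_eq_intros) auto
  from has_derivative_compose[OF this g]
  have "((\<lambda>y. g (u, y)) has_derivative (\<lambda>d. frechet_derivative g (at (u, v)) (0, d))) (at v)" .
  moreover have "frechet_derivative g (at (u, v)) (0, d) = d *\<^sub>R partial_v g (u, v)" for d
    using linear_cmul[OF has_derivative_linear[OF g], of d "(0,1)"] by (simp add: partial_v_def)
  ultimately show ?thesis by (simp add: has_vector_derivative_def)
qed

lemma partial_u_eqI:
  assumes "g differentiable (at (u, v))" "((\<lambda>x. g (x, v)) has_vector_derivative d) (at u)"
  shows "partial_u g (u, v) = d"
  using vector_derivative_unique_at[OF partial_u_vector_derivative[OF assms(1)] assms(2)] .

lemma has_derivative_partials: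
  assumes "g differentiable (at x)"
  shows "(g has_derivative (\<lambda>d. fst d *\<^sub>R partial_u g x + snd d *\<^sub>R partial_v g x)) (at x)"
proof -
  have g: "(g has_derivative frechet_derivative g (at x)) (at x)"
    using assms frechet_derivative_works by blast
  interpret bounded_linear "frechet_derivative g (at x)"
    using g by (rule has_derivative_bounded_linear)
  have "frechet_derivative g (at x) d = fst d *\<^sub>R partial_u g x + snd d *\<^sub>R partial_v g x" for d
    using add[of "fst d *\<^sub>R (1,0)" "snd d *\<^sub>R (0,1)"] scaleR[of "fst d" "(1,0)"] scaleR[of "snd d" "(0,1)"]
    by (simp add: partial_u_def partial_v_def)
  then have "frechet_derivative g (at x) = (\<lambda>d. fst d *\<^sub>R partial_u g x + snd d *\<^sub>R partial_v g x)" by blast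
  with g show ?thesis by simp
qed

lemma Basis_real_prod: "(Basis :: (real \<times> real) set) = {(1,0), (0,1)}"
  by (auto simp: Basis_prod_def)

lemma smooth_on_partials:
  assumes "smooth_on U g"
  shows "smooth_on U (partial_u g)" "smooth_on U (partial_v g)"
  using smooth_on_frechet_derivative[OF assms, of "(1,0)"] smooth_on_frechet_derivative[OF assms, of "(0,1)"]
  by (auto simp: Basis_real_prod partial_u_def[abs_def] partial_v_def[abs_def])

section \<open>Averages along segments issuing from the v-axis\<close>

lemma square_scale_fst:
  assumes "x \<in> square e" "t \<in> {0..1}"
  shows "(t * fst x, snd x) \<in> square e"
proof -
  have "\<bar>t * fst x\<bar> \<le> \<bar>fst x\<bar>"
    using assms(2) by (simp add: abs_mult mult_left_le_one_le)
  then show ?thesis using assms(1) by (cases x) (auto simp: in_square_iff)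
qed

lemma continuous_on_scale_fst:
  assumes "continuous_on (square e) G"
  shows "continuous_on (square e \<times> {0..1}) (\<lambda>z. G (snd z * fst (fst z), snd (fst z)))"
  by (rule continuous_on_compose2[OF assms]) (auto intro!: continuous_intros square_scale_fst)

text \<open>The weight \<open>t ^ m\<close> makes this family of integrals closed under partial derivatives, so that
  smoothness follows by induction on the order.\<close>

definition avg_fst :: "nat \<Rightarrow> (real \<times> real \<Rightarrow> real) \<Rightarrow> real \<times> real \<Rightarrow> real" where
  "avg_fst m G x = integral {0..1} (\<lambda>t. t ^ m * G (t * fst x, snd x))"

lemma avg_fst_integrable:
  assumes "continuous_on (square e) G" "x \<in> square e"
  shows "(\<lambda>t. t ^ m * G (t * fst x, snd x)) integrable_on {0..1}"
  by (intro integrable_continuous_interval continuous_intros continuous_on_compose2[OF assms(1)])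
    (use square_scale_fst[OF assms(2)] in auto)

text \<open>Differentiation under the integral sign. The inner derivative of
  \<open>t * fst x\<close> supplies a factor \<open>t\<close>, which raises the weight from
  \<open>m\<close> to \<open>Suc m\<close>.\<close>

lemma avg_fst_has_derivative:
  assumes G: "smooth_on (square e) G" and x0: "x0 \<in> square e"
  shows "(avg_fst m G has_derivative
    (\<lambda>d. fst d * avg_fst (Suc m) (partial_u G) x0 + snd d * avg_fst m (partial_v G) x0)) (at x0)"
proof -
  \<comment> \<open>The two projections as elements of the normed space of bounded linear maps, in
    which \<open>leibniz_rule\<close> integrates the derivative.\<close>
  define F S :: "(real \<times> real) \<Rightarrow>\<^sub>L real" where "F = Blinfun fst" and "S = Blinfun snd"
  have [simp]: "blinfun_apply F = fst" "blinfun_apply S = snd"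
    by (simp_all add: F_def S_def bounded_linear_Blinfun_apply bounded_linear_fst bounded_linear_snd)
  define fx where "fx x t = (t ^ Suc m * partial_u G (t * fst x, snd x)) *\<^sub>R F
      + (t ^ m * partial_v G (t * fst x, snd x)) *\<^sub>R S" for x :: "real \<times> real" and t
  note cont = smooth_on_continuous[OF G] smooth_on_continuous[OF smooth_on_partials(1)[OF G]]
    smooth_on_continuous[OF smooth_on_partials(2)[OF G]]
  have cfx: "continuous_on (square e \<times> {0..1}) (\<lambda>z. fx (fst z) (snd z))"
    unfolding fx_def
    by (intro continuous_intros continuous_on_scale_fst[OF cont(2)] continuous_on_scale_fst[OF cont(3)])
  have "((\<lambda>x. integral (cbox 0 1) (\<lambda>t. t ^ m * G (t * fst x, snd x))) has_derivative
      blinfun_apply (integral (cbox 0 1) (fx x0))) (at x0 within square e)"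
  proof (rule leibniz_rule[OF _ _ _ x0 convex_square])
    fix x :: "real \<times> real" and t :: real
    assume x: "x \<in> square e" and "t \<in> cbox 0 1"
    then have t: "(t * fst x, snd x) \<in> square e" by (intro square_scale_fst) auto
    have "((\<lambda>x. (t * fst x, snd x)) has_derivative (\<lambda>d. (t * fst d, snd d))) (at x)"
      by (auto intro!: derivative_eq_intros)
    from has_derivative_compose[OF this has_derivative_partials[OF smooth_on_differentiable[OF G t]]]
    have "((\<lambda>x. G (t * fst x, snd x)) has_derivative
        (\<lambda>d. t * fst d * partial_u G (t * fst x, snd x) + snd d * partial_v G (t * fst x, snd x))) (at x)"
      by simp
    then have "((\<lambda>x. t ^ m * G (t * fst x, snd x)) has_derivative
        (\<lambda>d. t ^ m * (t * fst d * partial_u G (t * fst x, snd x) + snd d * partial_v G (t * fst x, snd x)))) (at x)"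
      by (rule has_derivative_mult_right)
    moreover have "blinfun_apply (fx x t) =
       (\<lambda>d. t ^ m * (t * fst d * partial_u G (t * fst x, snd x) + snd d * partial_v G (t * fst x, snd x)))"
      by (auto simp: fx_def blinfun.add_left blinfun.scaleR_left algebra_simps)
    ultimately show "((\<lambda>x. t ^ m * G (t * fst x, snd x)) has_derivative blinfun_apply (fx x t)) (at x within square e)"
      using has_derivative_at_withinI by metis
  next
    show "(\<lambda>t. t ^ m * G (t * fst x, snd x)) integrable_on cbox 0 1" if "x \<in> square e" for x
      using avg_fst_integrable[OF cont(1) that] by simp
    show "continuous_on (square e \<times> cbox 0 1) (\<lambda>(x, t). fx x t)"
      using cfx by (simp add: case_prod_beta)
  qed
  then have main: "(avg_fst m G has_derivative blinfun_apply (integral {0..1} (fx x0))) (at x0)"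
    by (simp only: avg_fst_def[abs_def] at_within_open[OF x0 open_square] cbox_interval)
  have "continuous_on {0..1} (\<lambda>t. fx (fst (x0, t)) (snd (x0, t)))"
    by (rule continuous_on_compose2[OF cfx]) (use x0 in \<open>auto intro!: continuous_intros\<close>)
  then have "continuous_on {0..1} (fx x0)" by simp
  then have int: "fx x0 integrable_on {0..1}" by (rule integrable_continuous_interval)
  have "blinfun_apply (integral {0..1} (fx x0)) d =
     fst d * avg_fst (Suc m) (partial_u G) x0 + snd d * avg_fst m (partial_v G) x0" for d
  proof -
    have "blinfun_apply (integral {0..1} (fx x0)) d = integral {0..1} (\<lambda>t. blinfun_apply (fx x0 t) d)"
      by (rule blinfun_apply_integral[OF int])
    also have "\<dots> = integral {0..1} (\<lambda>t. fst d * (t ^ Suc m * partial_u G (t * fst x0, snd x0))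
         + snd d * (t ^ m * partial_v G (t * fst x0, snd x0)))"
      by (simp add: fx_def blinfun.add_left blinfun.scaleR_left mult.commute)
    also have "\<dots> = fst d * avg_fst (Suc m) (partial_u G) x0 + snd d * avg_fst m (partial_v G) x0"
      unfolding avg_fst_def
      by (subst integral_add)
        (auto intro!: integrable_on_mult_right avg_fst_integrable[OF cont(2) x0, simplified]
           avg_fst_integrable[OF cont(3) x0] avg_fst_integrable[OF cont(2) x0, of "Suc m", simplified])
    finally show ?thesis .
  qed
  with main show ?thesis by (metis (no_types, lifting) ext)
qed

lemma smooth_on_avg_fst:
  assumes "smooth_on (square e) G"
  shows "smooth_on (square e) (avg_fst m G)"
proof -
  have "ck_on k (square e) (avg_fst m G)" for k
    using assms
  proof (induction k arbitrary: m G)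
    case 0
    show ?case by (rule ck_on_0_has_derivative[OF avg_fst_has_derivative[OF 0]])
  next
    case (Suc k)
    show ?case
    proof (rule ck_on_Suc_has_derivative[OF open_square avg_fst_has_derivative[OF Suc.prems]])
      fix d :: "real \<times> real" assume "d \<in> Basis"
      then show "ck_on k (square e) (\<lambda>x. fst d * avg_fst (Suc m) (partial_u G) x + snd d * avg_fst m (partial_v G) x)"
        using Suc.IH[OF smooth_on_partials(1)[OF Suc.prems], of "Suc m"]
          Suc.IH[OF smooth_on_partials(2)[OF Suc.prems], of m]
        by (auto simp: Basis_real_prod)
    qed
  qed
  then show ?thesis unfolding smooth_on_iff_ck_on by blast
qed

text \<open>The quotient is the mean of \<open>partial_u h\<close> over the segment from (0, v) to
  (u, v), by the fundamental theorem of calculus along that segment. It is smooth across the axis,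
  where plain division by u would fail.\<close>

lemma hadamard_fst:
  assumes h: "smooth_on (square e) h" and h0: "\<And>v. \<bar>v\<bar> < e \<Longrightarrow> h (0, v) = 0"
  obtains k where "smooth_on (square e) k" "\<And>u v. (u, v) \<in> square e \<Longrightarrow> h (u, v) = u * k (u, v)"
proof
  show "smooth_on (square e) (avg_fst 0 (partial_u h))"
    by (intro smooth_on_avg_fst smooth_on_partials h)
  fix u v assume uv: "(u, v) \<in> square e"
  have "((\<lambda>t. u * partial_u h (t * u, v)) has_integral h (1 * u, v) - h (0 * u, v)) {0..1}"
  proof (rule fundamental_theorem_of_calculus)
    fix t :: real assume t: "t \<in> {0..1}"
    have "((\<lambda>x. h (x, v)) has_vector_derivative partial_u h (t * u, v)) (at (t * u))"
      using square_scale_fst[OF uv t] by (intro partial_u_vector_derivative smooth_on_differentiable[OF h]) auto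
    then have "((\<lambda>x. h (x, v)) has_field_derivative partial_u h (t * u, v)) (at (t * u))"
      by (simp add: has_real_derivative_iff_has_vector_derivative)
    then have "((\<lambda>t. h (t * u, v)) has_field_derivative partial_u h (t * u, v) * u) (at t)"
      by (rule DERIV_chain2[of "\<lambda>x. h (x, v)" _ "\<lambda>t. t * u"]) (auto intro!: derivative_eq_intros)
    then show "((\<lambda>t. h (t * u, v)) has_vector_derivative u * partial_u h (t * u, v)) (at t within {0..1})"
      by (simp add: has_real_derivative_iff_has_vector_derivative mult.commute has_vector_derivative_at_within)
  qed simp
  then have "integral {0..1} (\<lambda>t. u * partial_u h (t * u, v)) = h (1 * u, v) - h (0 * u, v)"
    by (rule integral_unique)
  then show "h (u, v) = u * avg_fst 0 (partial_u h) (u, v)"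
    using h0[of v] uv by (simp add: avg_fst_def in_square_iff)
qed

text \<open>On the axis the first quotient equals \<open>partial_u h\<close>, because the other term
  of the product rule carries the factor u = 0. So the quotient vanishes there and can be divided
  once more.\<close>

lemma hadamard_fst_2:
  assumes h: "smooth_on (square e) h" and h0: "\<And>v. \<bar>v\<bar> < e \<Longrightarrow> h (0, v) = 0"
    and h1: "\<And>v. \<bar>v\<bar> < e \<Longrightarrow> partial_u h (0, v) = 0"
  obtains k where "smooth_on (square e) k" "\<And>u v. (u, v) \<in> square e \<Longrightarrow> h (u, v) = u\<^sup>2 * k (u, v)"
proof -
  obtain k where k: "smooth_on (square e) k" "\<And>u v. (u, v) \<in> square e \<Longrightarrow> h (u, v) = u * k (u, v)"
    using hadamard_fst[OF h h0] by blast
  have "k (0, v) = 0" if v: "\<bar>v\<bar> < e" for v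
  proof -
    have sq: "(0, v) \<in> square e" using v by (simp add: in_square_iff)
    have kd: "((\<lambda>x. k (x, v)) has_vector_derivative partial_u k (0, v)) (at 0)"
      by (rule partial_u_vector_derivative[OF smooth_on_differentiable[OF k(1) sq]])
    then have "((\<lambda>x. k (x, v)) has_field_derivative partial_u k (0, v)) (at 0)"
      by (simp add: has_real_derivative_iff_has_vector_derivative)
    then have "((\<lambda>x. x * k (x, v)) has_field_derivative k (0, v)) (at 0)"
      by (auto intro!: derivative_eq_intros)
    then have "((\<lambda>x. x * k (x, v)) has_vector_derivative k (0, v)) (at 0)"
      by (simp add: has_real_derivative_iff_has_vector_derivative)
    then have "((\<lambda>x. h (x, v)) has_vector_derivative k (0, v)) (at 0)"
      by (rule has_vector_derivative_transform_within_open[of _ _ _ "{-e<..<e}"])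
        (use v k(2) in \<open>auto simp: in_square_iff\<close>)
    then have "partial_u h (0, v) = k (0, v)"
      by (intro partial_u_eqI smooth_on_differentiable[OF h sq])
    then show ?thesis using h1[OF v] by simp
  qed
  then obtain k' where "smooth_on (square e) k'" "\<And>u v. (u, v) \<in> square e \<Longrightarrow> k (u, v) = u * k' (u, v)"
    using hadamard_fst[OF k(1)] by blast
  then show thesis using that[of k'] k(2) by (simp add: power2_eq_square)
qed

section \<open>Functions of one variable and restriction to the axes\<close>

lemma smooth_on_real_has_derivative:
  fixes p :: "real \<Rightarrow> real"
  assumes "smooth_on U p" "x \<in> U"
  shows "(p has_field_derivative frechet_derivative p (at x) 1) (at x)"
proof -
  have p: "(p has_derivative frechet_derivative p (at x)) (at x)"
    by (rule smooth_on_has_derivative[OF assms])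
  have "frechet_derivative p (at x) d = frechet_derivative p (at x) 1 * d" for d
    using linear_cmul[OF has_derivative_linear[OF p], of d 1]
    by (simp only: real_scaleR_def mult_1_right mult.commute[of d])
  then have "frechet_derivative p (at x) = (*) (frechet_derivative p (at x) 1)"
    by (rule ext)
  with p show ?thesis unfolding has_field_derivative_def by metis
qed

lemma partial_u_real_derivative:
  fixes g :: "real \<times> real \<Rightarrow> real"
  assumes "smooth_on U g" "(u, v) \<in> U"
  shows "((\<lambda>x. g (x, v)) has_field_derivative partial_u g (u, v)) (at u)"
  using partial_u_vector_derivative[OF smooth_on_differentiable[OF assms]]
  by (simp add: has_real_derivative_iff_has_vector_derivative)

lemma partial_v_real_derivative:
  fixes g :: "real \<times> real \<Rightarrow> real"
  assumes "smooth_on U g" "(u, v) \<in> U"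
  shows "((\<lambda>y. g (u, y)) has_field_derivative partial_v g (u, v)) (at v)"
  using partial_v_vector_derivative[OF smooth_on_differentiable[OF assms]]
  by (simp add: has_real_derivative_iff_has_vector_derivative)

lemma partial_u_real_eqI:
  fixes g :: "real \<times> real \<Rightarrow> real"
  assumes "smooth_on U g" "(u, v) \<in> U" "((\<lambda>x. g (x, v)) has_field_derivative d) (at u)"
  shows "partial_u g (u, v) = d"
  using DERIV_unique[OF partial_u_real_derivative[OF assms(1,2)] assms(3)] .

lemma partial_v_real_eqI:
  fixes g :: "real \<times> real \<Rightarrow> real"
  assumes "smooth_on U g" "(u, v) \<in> U" "((\<lambda>y. g (u, y)) has_field_derivative d) (at v)"
  shows "partial_v g (u, v) = d"
  using DERIV_unique[OF partial_v_real_derivative[OF assms(1,2)] assms(3)] .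

lemma smooth_on_square_fst:
  "smooth_on (square e) h \<Longrightarrow> 0 < e \<Longrightarrow> smooth_on {-e<..<e} (\<lambda>u. h (u, 0))"
  by (rule smooth_on_compose[of _ "\<lambda>u. (u, 0)" "square e" h])
    (auto simp: in_square_iff intro!: smooth_on_Pair smooth_on_ident smooth_on_const)

lemma smooth_on_square_snd:
  "smooth_on (square e) h \<Longrightarrow> 0 < e \<Longrightarrow> smooth_on {-e<..<e} (\<lambda>v. h (0, v))"
  by (rule smooth_on_compose[of _ "\<lambda>u. (0, u)" "square e" h])
    (auto simp: in_square_iff intro!: smooth_on_Pair smooth_on_ident smooth_on_const)

lemma smooth_on_real_fst:
  "smooth_on {-e<..<e} (p :: real \<Rightarrow> real) \<Longrightarrow> smooth_on (square e) (\<lambda>x. p (fst x))"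
  by (rule smooth_on_compose[of _ fst "{-e<..<e}" p])
    (auto simp: square_def intro!: open_Times smooth_on_bounded_linear bounded_linear_fst)

lemma smooth_on_real_snd:
  "smooth_on {-e<..<e} (p :: real \<Rightarrow> real) \<Longrightarrow> smooth_on (square e) (\<lambda>x. p (snd x))"
  by (rule smooth_on_compose[of _ snd "{-e<..<e}" p])
    (auto simp: square_def intro!: open_Times smooth_on_bounded_linear bounded_linear_snd)

lemma smooth_on_square_swap:
  "smooth_on (square e) h \<Longrightarrow> smooth_on (square e) (\<lambda>x. h (snd x, fst x))"
  by (rule smooth_on_compose[of _ "\<lambda>x. (snd x, fst x)" "square e" h])
    (auto simp: square_def intro!: open_Times smooth_on_Pair smooth_on_fst smooth_on_snd smooth_on_ident)

lemma hadamard_snd_2: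
  assumes h: "smooth_on (square e) h" and h0: "\<And>u. \<bar>u\<bar> < e \<Longrightarrow> h (u, 0) = 0"
    and h1: "\<And>u. \<bar>u\<bar> < e \<Longrightarrow> partial_v h (u, 0) = 0"
  obtains k where "smooth_on (square e) k" "\<And>u v. (u, v) \<in> square e \<Longrightarrow> h (u, v) = v\<^sup>2 * k (u, v)"
proof -
  let ?h = "\<lambda>x. h (snd x, fst x)"
  note sw = smooth_on_square_swap[OF h]
  have "partial_u ?h (0, v) = 0" if v: "\<bar>v\<bar> < e" for v
  proof (rule partial_u_real_eqI[OF sw])
    show "((\<lambda>x. ?h (x, v)) has_field_derivative 0) (at 0)"
      using partial_v_real_derivative[OF h, of v 0] h1[OF v] v by (simp add: in_square_iff)
  qed (use v in \<open>auto simp: in_square_iff\<close>)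
  then obtain k where k: "smooth_on (square e) k" "\<And>u v. (u, v) \<in> square e \<Longrightarrow> ?h (u, v) = u\<^sup>2 * k (u, v)"
    using hadamard_fst_2[OF sw] h0 by auto
  show thesis
  proof (rule that[OF smooth_on_square_swap[OF k(1)]])
    fix u v assume "(u, v) \<in> square e"
    then show "h (u, v) = v\<^sup>2 * k (snd (u, v), fst (u, v))"
      using k(2)[of v u] by (simp add: in_square_iff)
  qed
qed

lemma hadamard_real:
  assumes p: "smooth_on {-e<..<e} (p :: real \<Rightarrow> real)" and "0 < e"
  obtains b where "smooth_on {-e<..<e} b" "\<And>u. \<bar>u\<bar> < e \<Longrightarrow> p u = p 0 + u * b u"
proof -
  have "smooth_on (square e) (\<lambda>x. p (fst x) - p 0)"
    by (intro smooth_on_diff smooth_on_real_fst p open_square smooth_on_const)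
  then obtain k where k: "smooth_on (square e) k"
      "\<And>u v. (u, v) \<in> square e \<Longrightarrow> p (fst (u, v)) - p 0 = u * k (u, v)"
    by (rule hadamard_fst) auto
  show thesis
  proof (rule that[OF smooth_on_square_fst[OF k(1) \<open>0 < e\<close>]])
    show "p u = p 0 + u * k (u, 0)" if "\<bar>u\<bar> < e" for u
      using k(2)[of u 0] that \<open>0 < e\<close> by (simp add: in_square_iff)
  qed
qed

text \<open>Cancelling a power of u is legitimate only away from 0; this recovers the identity at
  0.\<close>

lemma continuous_on_eq_at_0:
  fixes \<phi> :: "real \<Rightarrow> real"
  assumes "continuous_on {-e<..<e} \<phi>" "0 < e" "\<And>u. u \<noteq> 0 \<Longrightarrow> \<bar>u\<bar> < e \<Longrightarrow> \<phi> u = c"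
  shows "\<phi> 0 = c"
proof (rule tendsto_unique[of "at (0::real)"])
  have "isCont \<phi> 0"
    using assms(1,2) by (simp add: continuous_on_eq_continuous_at)
  then show "(\<phi> \<longlongrightarrow> \<phi> 0) (at 0)" by (simp add: isCont_def)
  have "eventually (\<lambda>u. \<phi> u = c) (at 0)"
    unfolding eventually_at using assms(2,3) by (intro exI[of _ e]) auto
  then show "(\<phi> \<longlongrightarrow> c) (at 0)" by (rule tendsto_eventually)
qed simp

text \<open>Differentiating \<open>u^2 * p u\<close> and cancelling u gives \<phi> = 2 p + u p' away
  from 0, and continuity extends the equality to 0.\<close>

lemma quadratic_coefficient:
  assumes p: "smooth_on {-e<..<e} (p :: real \<Rightarrow> real)" and "0 < e"
    and \<phi>: "continuous_on {-e<..<e} \<phi>"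
    and der: "\<And>u. \<bar>u\<bar> < e \<Longrightarrow> ((\<lambda>u. u\<^sup>2 * p u) has_field_derivative u * \<phi> u) (at u)"
  shows "\<phi> 0 = 2 * p 0"
proof -
  define p' where "p' x = frechet_derivative p (at x) 1" for x
  have p': "continuous_on {-e<..<e} p'"
    using smooth_on_continuous[OF smooth_on_frechet_derivative[OF p, of 1]] by (simp add: p'_def[abs_def])
  have "\<phi> 0 - (2 * p 0 + 0 * p' 0) = 0"
  proof (rule continuous_on_eq_at_0[of e "\<lambda>u. \<phi> u - (2 * p u + u * p' u)"])
    show "continuous_on {-e<..<e} (\<lambda>u. \<phi> u - (2 * p u + u * p' u))"
      by (intro continuous_intros \<phi> p' smooth_on_continuous[OF p])
  next
    fix u :: real assume u: "u \<noteq> 0" "\<bar>u\<bar> < e"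
    have "(p has_field_derivative p' u) (at u)"
      unfolding p'_def by (rule smooth_on_real_has_derivative[OF p]) (use u in auto)
    then have "((\<lambda>u. u\<^sup>2 * p u) has_field_derivative 2 * u * p u + u\<^sup>2 * p' u) (at u)"
      by (auto intro!: derivative_eq_intros)
    then have "u * \<phi> u = 2 * u * p u + u\<^sup>2 * p' u"
      using der[OF u(2)] DERIV_unique by blast
    then have "u * \<phi> u = u * (2 * p u + u * p' u)"
      by (simp add: algebra_simps power2_eq_square)
    then show "\<phi> u - (2 * p u + u * p' u) = 0" using u(1) by simp
  qed (rule \<open>0 < e\<close>)
  then show ?thesis by simp
qed

text \<open>What is kept of the factorisations of the partial derivatives by u and by v. It concerns
  scalar functions, so it applies to each component separately, and it is stable under the
  coordinate change made later.\<close>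

definition axis_critical :: "real \<Rightarrow> (real \<times> real \<Rightarrow> real) \<Rightarrow> bool" where
  "axis_critical e h \<longleftrightarrow> (\<forall>w. \<bar>w\<bar> < e \<longrightarrow> partial_u h (0, w) = 0 \<and> partial_v h (w, 0) = 0)"

text \<open>Subtracting the restrictions to the two axes leaves a remainder that vanishes to second
  order along both; it is divided first by \<open>u^2\<close> and then by \<open>v^2\<close>. The
  restrictions supply the one-variable terms.\<close>

lemma axis_critical_decomposition:
  assumes h: "smooth_on (square e) h" and "0 < e" and h0: "h (0, 0) = 0" and crit: "axis_critical e h"
  obtains p q r where "smooth_on {-e<..<e} p" "smooth_on {-e<..<e} q" "smooth_on (square e) r"
    "\<And>u v. (u, v) \<in> square e \<Longrightarrow> h (u, v) = u\<^sup>2 * p u + v\<^sup>2 * q v + u\<^sup>2 * v\<^sup>2 * r (u, v)"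
proof -
  note e = \<open>0 < e\<close>
  have cu: "partial_u h (0, w) = 0" and cv: "partial_v h (w, 0) = 0" if "\<bar>w\<bar> < e" for w
    using crit that by (auto simp: axis_critical_def)
  \<comment> \<open>The restrictions are regarded as functions on the square, so that the planar
    division lemmas apply to them.\<close>
  define hu where "hu x = h (fst x, 0)" for x :: "real \<times> real"
  define hv where "hv x = h (0, snd x)" for x :: "real \<times> real"
  have hu: "smooth_on (square e) hu" and hv: "smooth_on (square e) hv"
    unfolding hu_def[abs_def] hv_def[abs_def]
    by (intro smooth_on_real_fst smooth_on_real_snd smooth_on_square_fst smooth_on_square_snd h e)+
  have "hu (0, v) = 0" "partial_u hu (0, v) = 0" if "\<bar>v\<bar> < e" for v
    using h0 partial_u_real_derivative[OF h, of 0 0] cu[of 0] e that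
    by (auto simp: hu_def in_square_iff intro!: partial_u_real_eqI[OF hu])
  then obtain p where p: "smooth_on (square e) p" "\<And>u v. (u, v) \<in> square e \<Longrightarrow> hu (u, v) = u\<^sup>2 * p (u, v)"
    using hadamard_fst_2[OF hu] by blast
  have "hv (u, 0) = 0" "partial_v hv (u, 0) = 0" if "\<bar>u\<bar> < e" for u
    using h0 partial_v_real_derivative[OF h, of 0 0] cv[of 0] e that
    by (auto simp: hv_def in_square_iff intro!: partial_v_real_eqI[OF hv])
  then obtain q where q: "smooth_on (square e) q" "\<And>u v. (u, v) \<in> square e \<Longrightarrow> hv (u, v) = v\<^sup>2 * q (u, v)"
    using hadamard_snd_2[OF hv] by blast
  define m where "m x = h x - hu x - hv x" for x
  have m: "smooth_on (square e) m"
    unfolding m_def[abs_def] by (intro smooth_on_diff open_square h hu hv)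
  have mu: "m (0, v) = 0" "partial_u m (0, v) = 0" if "\<bar>v\<bar> < e" for v
  proof -
    show "m (0, v) = 0" by (simp add: m_def hu_def hv_def h0)
    have "((\<lambda>x. h (x, v) - h (x, 0) - h (0, v)) has_field_derivative 0) (at 0)"
      using partial_u_real_derivative[OF h, of 0 v] partial_u_real_derivative[OF h, of 0 0] cu[of v] cu[of 0] e that
      by (auto simp: in_square_iff intro!: derivative_eq_intros)
    then show "partial_u m (0, v) = 0"
      using that e by (intro partial_u_real_eqI[OF m]) (auto simp: in_square_iff m_def hu_def hv_def)
  qed
  have mv: "m (u, 0) = 0" "partial_v m (u, 0) = 0" if "\<bar>u\<bar> < e" for u
  proof -
    show "m (u, 0) = 0" by (simp add: m_def hu_def hv_def h0)
    have "((\<lambda>y. h (u, y) - h (u, 0) - h (0, y)) has_field_derivative 0) (at 0)"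
      using partial_v_real_derivative[OF h, of u 0] partial_v_real_derivative[OF h, of 0 0] cv[of u] cv[of 0] e that
      by (auto simp: in_square_iff intro!: derivative_eq_intros)
    then show "partial_v m (u, 0) = 0"
      using that e by (intro partial_v_real_eqI[OF m]) (auto simp: in_square_iff m_def hu_def hv_def)
  qed
  obtain k where k: "smooth_on (square e) k" "\<And>u v. (u, v) \<in> square e \<Longrightarrow> m (u, v) = u\<^sup>2 * k (u, v)"
    using hadamard_fst_2[OF m mu] by blast
  \<comment> \<open>Vanishing passes from \<open>m\<close> to the quotient \<open>k\<close> only
    where u is nonzero; the point u = 0 is filled in by continuity of \<open>k\<close> and of
    \<open>partial_v k\<close>.\<close>
  have k0': "k (u, 0) = 0" "partial_v k (u, 0) = 0" if u: "u \<noteq> 0" "\<bar>u\<bar> < e" for u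
  proof -
    have sq: "(u, 0) \<in> square e" using u e by (simp add: in_square_iff)
    show "k (u, 0) = 0" using k(2)[OF sq] mv(1)[OF u(2)] u(1) by simp
    have "((\<lambda>y. u\<^sup>2 * k (u, y)) has_field_derivative u\<^sup>2 * partial_v k (u, 0)) (at 0)"
      using partial_v_real_derivative[OF k(1) sq] by (rule DERIV_cmult)
    then have "((\<lambda>y. m (u, y)) has_field_derivative u\<^sup>2 * partial_v k (u, 0)) (at 0)"
      by (rule has_field_derivative_transform_within_open[of _ _ _ "{-e<..<e}"])
        (use u e k(2) in \<open>auto simp: in_square_iff\<close>)
    then have "partial_v m (u, 0) = u\<^sup>2 * partial_v k (u, 0)"
      by (rule partial_v_real_eqI[OF m sq])
    then show "partial_v k (u, 0) = 0" using mv(2)[OF u(2)] u(1) by simp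
  qed
  have "k (0, 0) = 0"
    using continuous_on_eq_at_0[OF smooth_on_continuous[OF smooth_on_square_fst[OF k(1) e]] e k0'(1)] .
  moreover have "partial_v k (0, 0) = 0"
    using continuous_on_eq_at_0[OF smooth_on_continuous[OF smooth_on_square_fst[OF smooth_on_partials(2)[OF k(1)] e]] e k0'(2)] .
  ultimately have k0: "k (u, 0) = 0" "partial_v k (u, 0) = 0" if "\<bar>u\<bar> < e" for u
    using k0' that by (metis, metis)
  obtain r where r: "smooth_on (square e) r" "\<And>u v. (u, v) \<in> square e \<Longrightarrow> k (u, v) = v\<^sup>2 * r (u, v)"
    using hadamard_snd_2[OF k(1) k0] by blast
  show thesis
  proof (rule that[OF smooth_on_square_fst[OF p(1) e] smooth_on_square_snd[OF q(1) e] r(1)])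
    fix u v assume uv: "(u, v) \<in> square e"
    have "hu (u, 0) = u\<^sup>2 * p (u, 0)" "hv (0, v) = v\<^sup>2 * q (0, v)"
      using p(2)[of u 0] q(2)[of 0 v] uv e by (auto simp: in_square_iff)
    moreover have "h (u, v) = hu (u, 0) + hv (0, v) + m (u, v)"
      by (simp add: m_def hu_def hv_def)
    ultimately show "h (u, v) = u\<^sup>2 * p (u, 0) + v\<^sup>2 * q (0, v) + u\<^sup>2 * v\<^sup>2 * r (u, v)"
      using k(2)[OF uv] r(2)[OF uv] by simp
  qed
qed

section \<open>Local diffeomorphisms of the plane\<close>

lemma jac_det_partials:
  "jac_det s x = fst (partial_u s x) * snd (partial_v s x) - snd (partial_u s x) * fst (partial_v s x)"
  by (simp add: jac_det_def partial_u_def partial_v_def Let_def)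

lemma partials_from_derivative:
  assumes "(g has_derivative D) (at x)"
  shows "partial_u g x = D (1, 0)" "partial_v g x = D (0, 1)"
  using frechet_derivative_at[OF assms] by (simp_all add: partial_u_def partial_v_def)

lemma has_derivative_chain_partials:
  fixes h :: "'a::real_normed_vector \<Rightarrow> real \<times> real"
  assumes "(h has_derivative D) (at x)" "g differentiable (at (h x))"
  shows "((\<lambda>x. g (h x)) has_derivative
    (\<lambda>d. fst (D d) *\<^sub>R partial_u g (h x) + snd (D d) *\<^sub>R partial_v g (h x))) (at x)"
  using has_derivative_compose[OF assms(1) has_derivative_partials[OF assms(2)]] .

lemma partials_compose:
  assumes "h differentiable (at x)" "g differentiable (at (h x))"
  shows "partial_u (\<lambda>x. g (h x)) x =
      fst (partial_u h x) *\<^sub>R partial_u g (h x) + snd (partial_u h x) *\<^sub>R partial_v g (h x)"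
    and "partial_v (\<lambda>x. g (h x)) x =
      fst (partial_v h x) *\<^sub>R partial_u g (h x) + snd (partial_v h x) *\<^sub>R partial_v g (h x)"
  using partials_from_derivative[OF has_derivative_chain_partials[OF
        differentiable_has_frechet_derivative[OF assms(1)] assms(2)]]
  by (simp_all add: partial_u_def partial_v_def)

lemma jac_det_compose:
  assumes "h differentiable (at x)" "g differentiable (at (h x))"
  shows "jac_det (\<lambda>x. g (h x)) x = jac_det g (h x) * jac_det h x"
  unfolding jac_det_partials partials_compose[OF assms] by (simp add: algebra_simps)

lemma partials_local_identity:
  assumes "open U" "x \<in> U" "\<And>y. y \<in> U \<Longrightarrow> g y = y"
  shows "partial_u g x = (1, 0)" "partial_v g x = (0, 1)"
proof -
  have "(g has_derivative (\<lambda>d. d)) (at x)"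
    by (rule has_derivative_transform_within_open[OF has_derivative_ident assms(1,2)]) (use assms in auto)
  then show "partial_u g x = (1, 0)" "partial_v g x = (0, 1)"
    using partials_from_derivative by blast+
qed

lemma smooth_on_jac_det:
  assumes "open U" "smooth_on U s"
  shows "smooth_on U (jac_det s)"
  unfolding jac_det_partials[abs_def]
  by (intro smooth_on_diff smooth_on_mult smooth_on_fst smooth_on_snd smooth_on_partials assms)

lemma diffeo0_sym: "diffeo0 U V s t \<Longrightarrow> diffeo0 V U t s"
  unfolding diffeo0_def by (metis image_eqI)

lemma diffeo0_jac_det_nonzero:
  assumes "diffeo0 U V s t" "x \<in> U"
  shows "jac_det s x \<noteq> 0"
proof -
  have "s x \<in> V" using assms by (auto simp: diffeo0_def)
  then have d: "s differentiable (at x)" "t differentiable (at (s x))"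
    using assms by (auto simp: diffeo0_def intro: smooth_on_differentiable)
  have U: "open U" "\<And>y. y \<in> U \<Longrightarrow> t (s y) = y" using assms by (auto simp: diffeo0_def)
  have "jac_det (\<lambda>x. t (s x)) x = 1"
    using partials_local_identity[OF U(1) assms(2), of "\<lambda>x. t (s x)", OF U(2)] by (simp add: jac_det_partials)
  then show ?thesis using jac_det_compose[OF d] by auto
qed

lemma diffeo0_restrict:
  assumes "diffeo0 U V s t" "open W" "W \<subseteq> U" "0 \<in> W"
  shows "diffeo0 W (s ` W) s t"
proof -
  have D: "open U" "open V" "s ` U = V" "t ` V = U" "\<forall>x\<in>U. t (s x) = x" "\<forall>y\<in>V. s (t y) = y"
    "smooth_on U s" "smooth_on V t" "s 0 = 0"
    using assms(1) by (auto simp: diffeo0_def)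
  have "s ` W = V \<inter> t -` W"
  proof
    show "s ` W \<subseteq> V \<inter> t -` W" using D assms(3) by auto
    show "V \<inter> t -` W \<subseteq> s ` W" using D(6) by (metis Int_iff image_eqI subsetI vimageE)
  qed
  moreover have "open (V \<inter> t -` W)"
    by (rule continuous_open_preimage[OF smooth_on_continuous[OF D(8)] D(2) assms(2)])
  moreover have "t ` s ` W = W" using D(5) assms(3) by force
  moreover have "smooth_on W s" "smooth_on (s ` W) t"
    using smooth_on_subset[OF D(7) assms(3)] smooth_on_subset[OF D(8), of "s ` W"] D(3) assms(3) by auto
  moreover have "\<forall>x\<in>W. t (s x) = x" "\<forall>y\<in>s ` W. s (t y) = y"
    using D(5) assms(3) by auto
  ultimately show ?thesis
    unfolding diffeo0_def using D(9) assms by simp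
qed

lemma diffeo0_restrict_range:
  assumes "diffeo0 U V s t" "open W" "W \<subseteq> V" "0 \<in> W"
  shows "diffeo0 (t ` W) W s t"
  using diffeo0_restrict[OF diffeo0_sym[OF assms(1)] assms(2-4)] by (rule diffeo0_sym)

lemma diffeo0_compose:
  assumes "diffeo0 U V s t" "diffeo0 V W s' t'"
  shows "diffeo0 U W (\<lambda>x. s' (s x)) (\<lambda>y. t (t' y))"
proof -
  have A: "open U" "s ` U = V" "t ` V = U" "\<forall>x\<in>U. t (s x) = x" "\<forall>y\<in>V. s (t y) = y"
    "smooth_on U s" "smooth_on V t" "s 0 = 0" "0 \<in> U"
    using assms(1) by (auto simp: diffeo0_def)
  have B: "open W" "s' ` V = W" "t' ` W = V" "\<forall>x\<in>V. t' (s' x) = x" "\<forall>y\<in>W. s' (t' y) = y"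
    "smooth_on V s'" "smooth_on W t'" "s' 0 = 0"
    using assms(2) by (auto simp: diffeo0_def)
  have "smooth_on U (\<lambda>x. s' (s x))"
    by (rule smooth_on_compose[OF A(1,6) B(6)]) (use A in auto)
  moreover have "smooth_on W (\<lambda>y. t (t' y))"
    by (rule smooth_on_compose[OF B(1,7) A(7)]) (use B in auto)
  moreover have "(\<lambda>x. s' (s x)) ` U = W" "(\<lambda>y. t (t' y)) ` W = U"
    using A B by (metis image_image)+
  moreover have "\<forall>x\<in>U. t (t' (s' (s x))) = x" "\<forall>y\<in>W. s' (s (t (t' y))) = y"
    using A B by auto
  ultimately show ?thesis
    unfolding diffeo0_def using A B by simp
qed

text \<open>A bootstrap: by Cramer's rule the partial derivatives of \<open>t\<close> are smooth
  functions composed with \<open>t\<close>, so order \<open>k\<close> for \<open>t\<close> yields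
  order \<open>Suc k\<close>. Plain differentiability starts the induction.\<close>

lemma smooth_on_right_inverse:
  fixes s t :: "real \<times> real \<Rightarrow> real \<times> real"
  assumes U: "open U" "smooth_on U s" and V: "open V" "\<And>y. y \<in> V \<Longrightarrow> t y \<in> U"
    "\<And>y. y \<in> V \<Longrightarrow> s (t y) = y" "\<And>y. y \<in> V \<Longrightarrow> t differentiable (at y)"
  shows "smooth_on V t"
proof -
  \<comment> \<open>The region where Cramer's rule is available. It contains the values of
    \<open>t\<close>, since the two Jacobian determinants multiply to 1.\<close>
  define U' where "U' = {x \<in> U. jac_det s x \<noteq> 0}"
  have "U' = U \<inter> jac_det s -` (- {0})" by (auto simp: U'_def)
  then have U': "open U'"
    using continuous_open_preimage[OF smooth_on_continuous[OF smooth_on_jac_det[OF U]] U(1), of "- {0}"] by auto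
  have sU': "smooth_on U' s" using U(2) by (rule smooth_on_subset) (auto simp: U'_def)
  have sd: "s differentiable (at (t y))" if "y \<in> V" for y
    using V(2)[OF that] U(2) smooth_on_differentiable by blast
  have id: "fst (partial_u t y) *\<^sub>R partial_u s (t y) + snd (partial_u t y) *\<^sub>R partial_v s (t y) = (1, 0)"
      "fst (partial_v t y) *\<^sub>R partial_u s (t y) + snd (partial_v t y) *\<^sub>R partial_v s (t y) = (0, 1)"
    if "y \<in> V" for y
    using partials_compose[OF V(4)[OF that] sd[OF that]]
      partials_local_identity[OF V(1) that, of "\<lambda>y. s (t y)", OF V(3)] by simp_all
  have tU': "t y \<in> U'" if "y \<in> V" for y
  proof -
    have "jac_det (\<lambda>y. s (t y)) y = 1"
      using partials_local_identity[OF V(1) that, of "\<lambda>y. s (t y)", OF V(3)] by (simp add: jac_det_partials)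
    then show ?thesis
      using jac_det_compose[OF V(4)[OF that] sd[OF that]] V(2)[OF that] by (auto simp: U'_def)
  qed
  \<comment> \<open>\<open>P\<close> and \<open>Q\<close> are the two columns of the inverse
    Jacobian matrix of \<open>s\<close>.\<close>
  define P where "P x = (inverse (jac_det s x) * snd (partial_v s x), - (inverse (jac_det s x) * snd (partial_u s x)))" for x
  define Q where "Q x = (- (inverse (jac_det s x) * fst (partial_v s x)), inverse (jac_det s x) * fst (partial_u s x))" for x
  have PQ: "smooth_on U' P" "smooth_on U' Q"
    unfolding P_def[abs_def] Q_def[abs_def]
    by (auto intro!: smooth_on_Pair smooth_on_mult smooth_on_minus smooth_on_inverse smooth_on_fst smooth_on_snd
        smooth_on_partials smooth_on_jac_det U' sU' simp: U'_def[symmetric]) (auto simp: U'_def)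
  have cramer: "partial_u t y = P (t y)" "partial_v t y = Q (t y)" if "y \<in> V" for y
  proof -
    define a b c d where "a = fst (partial_u s (t y))" and "b = fst (partial_v s (t y))"
      and "c = snd (partial_u s (t y))" and "d = snd (partial_v s (t y))"
    have j: "jac_det s (t y) = a * d - c * b" "a * d - c * b \<noteq> 0"
      using tU'[OF that] by (auto simp: U'_def jac_det_partials a_def b_def c_def d_def)
    have e: "fst (partial_u t y) * a + snd (partial_u t y) * b = 1" "fst (partial_u t y) * c + snd (partial_u t y) * d = 0"
       "fst (partial_v t y) * a + snd (partial_v t y) * b = 0" "fst (partial_v t y) * c + snd (partial_v t y) * d = 1"
      using id[OF that] by (auto simp: a_def b_def c_def d_def prod_eq_iff)
    have "fst (partial_u t y) * (a * d - c * b) = d" "snd (partial_u t y) * (a * d - c * b) = - c"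
      "fst (partial_v t y) * (a * d - c * b) = - b" "snd (partial_v t y) * (a * d - c * b) = a"
      using e by algebra+
    then show "partial_u t y = P (t y)" "partial_v t y = Q (t y)"
      using j(2) by (auto simp: P_def Q_def j(1) prod_eq_iff a_def[symmetric] b_def[symmetric] c_def[symmetric]
          d_def[symmetric] nonzero_eq_divide_eq field_simps)
  qed
  have "ck_on k V t" for k
  proof (induction k)
    case 0
    show ?case using V(4) by simp
  next
    case (Suc k)
    have k: "ck_on k V (\<lambda>y. P (t y))" "ck_on k V (\<lambda>y. Q (t y))"
      using PQ tU' by (auto intro!: ck_on_compose[OF V(1) Suc.IH, of U'] simp: smooth_on_iff_ck_on)
    show ?case
    proof (rule ck_on_Suc_I)
      show "(t has_derivative frechet_derivative t (at y)) (at y)" if "y \<in> V" for y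
        by (rule differentiable_has_frechet_derivative[OF V(4)[OF that]])
      show "ck_on k V (\<lambda>y. frechet_derivative t (at y) d)" if "d \<in> Basis" for d
      proof (cases "d = (1, 0)")
        case True
        show ?thesis by (rule ck_on_cong[OF V(1) k(1)]) (simp add: True cramer(1)[symmetric] partial_u_def)
      next
        case False
        then have d: "d = (0, 1)" using that by (auto simp: Basis_real_prod)
        show ?thesis by (rule ck_on_cong[OF V(1) k(2)]) (simp add: d cramer(2)[symmetric] partial_v_def)
      qed
    qed
  qed
  then show ?thesis unfolding smooth_on_iff_ck_on by blast
qed

text \<open>The inverse function theorem provides a differentiable local inverse, and
  \<open>smooth_on_right_inverse\<close> upgrades it to a smooth one.\<close>

lemma smooth_inverse_function:
  fixes s :: "real \<times> real \<Rightarrow> real \<times> real"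
  assumes U: "open U" "smooth_on U s" "0 \<in> U" and s0: "s 0 = 0" and jac: "jac_det s 0 \<noteq> 0"
  obtains U' V t where "U' \<subseteq> U" "diffeo0 U' V s t"
proof -
  \<comment> \<open>The four matrix units as bounded linear maps. With the derivative expanded in
    them, its continuity in operator norm follows from continuity of the entries.\<close>
  define E1 E2 E3 E4 :: "(real \<times> real) \<Rightarrow>\<^sub>L (real \<times> real)"
    where "E1 = Blinfun (\<lambda>d. (fst d, 0))" and "E2 = Blinfun (\<lambda>d. (0, fst d))"
      and "E3 = Blinfun (\<lambda>d. (snd d, 0))" and "E4 = Blinfun (\<lambda>d. (0, snd d))"
  have [simp]: "blinfun_apply E1 = (\<lambda>d. (fst d, 0))" "blinfun_apply E2 = (\<lambda>d. (0, fst d))"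
     "blinfun_apply E3 = (\<lambda>d. (snd d, 0))" "blinfun_apply E4 = (\<lambda>d. (0, snd d))"
    unfolding E1_def E2_def E3_def E4_def
    by (auto intro!: bounded_linear_Blinfun_apply bounded_linear_Pair bounded_linear_fst bounded_linear_snd
         bounded_linear_zero)
  define s' where "s' x = fst (partial_u s x) *\<^sub>R E1 + snd (partial_u s x) *\<^sub>R E2
      + fst (partial_v s x) *\<^sub>R E3 + snd (partial_v s x) *\<^sub>R E4" for x
  define j where "j = inverse (jac_det s 0)"
  \<comment> \<open>The adjugate matrix divided by the determinant.\<close>
  define invf where "invf = (j * snd (partial_v s 0)) *\<^sub>R E1 - (j * snd (partial_u s 0)) *\<^sub>R E2
      - (j * fst (partial_v s 0)) *\<^sub>R E3 + (j * fst (partial_u s 0)) *\<^sub>R E4"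
  have der: "(s has_derivative blinfun_apply (s' x)) (at x)" if "x \<in> U" for x
  proof -
    have "blinfun_apply (s' x) = (\<lambda>d. fst d *\<^sub>R partial_u s x + snd d *\<^sub>R partial_v s x)"
      by (auto simp: s'_def blinfun.add_left blinfun.scaleR_left prod_eq_iff algebra_simps)
    then show ?thesis
      using has_derivative_partials[OF smooth_on_differentiable[OF U(2) that]] by simp
  qed
  have cont: "continuous_on U s'"
    unfolding s'_def[abs_def]
    by (intro continuous_intros smooth_on_continuous[OF smooth_on_partials(1)[OF U(2)]]
        smooth_on_continuous[OF smooth_on_partials(2)[OF U(2)]])
  have inv: "invf o\<^sub>L s' 0 = id_blinfun"
  proof (rule blinfun_eqI)
    fix d :: "real \<times> real"
    have jj: "j * (fst (partial_u s 0) * snd (partial_v s 0) - snd (partial_u s 0) * fst (partial_v s 0)) = 1"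
      using jac by (simp add: j_def jac_det_partials[symmetric])
    define a b c e where "a = fst (partial_u s 0)" and "b = fst (partial_v s 0)"
      and "c = snd (partial_u s 0)" and "e = snd (partial_v s 0)"
    have "blinfun_apply (invf o\<^sub>L s' 0) d = (j * (a * e - c * b) * fst d, j * (a * e - c * b) * snd d)"
      by (simp add: invf_def s'_def blinfun.add_left blinfun.diff_left blinfun.scaleR_left prod_eq_iff
          a_def b_def c_def e_def algebra_simps)
    then show "blinfun_apply (invf o\<^sub>L s' 0) d = blinfun_apply id_blinfun d"
      using jj by (simp add: a_def b_def c_def e_def)
  qed
  show thesis
  proof (rule inverse_function_theorem[OF U(1) _ cont U(3) inv])
    show "(s has_derivative blinfun_apply (s' x)) (at x)" if "x \<in> U" for x
      by (rule der[OF that])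
  next
    fix U' V t t'
    assume R: "open U'" "U' \<subseteq> U" "0 \<in> U'" "open V" "s 0 \<in> V" "homeomorphism U' V s t"
      "\<And>y. y \<in> V \<Longrightarrow> (t has_derivative t' y) (at y)"
    have sU': "smooth_on U' s" using U(2) R(2) by (rule smooth_on_subset)
    have "smooth_on V t"
      by (rule smooth_on_right_inverse[OF R(1) sU' R(4)])
        (use R(6,7) in \<open>auto simp: homeomorphism_def differentiable_def\<close>)
    then have "diffeo0 U' V s t"
      using R sU' s0 by (auto simp: diffeo0_def homeomorphism_def)
    with R(2) show thesis by (rule that)
  qed
qed

section \<open>Adapted rotation and coordinates\<close>

text \<open>Scaling both vectors to unit length is what makes their difference and sum orthogonal.
  In that frame they differ only in the sign of the first coordinate, hence a single ratio
  \<open>a\<close> for both. Independence keeps the difference and the sum nonzero.\<close>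

lemma rotation_adapted:
  fixes p q :: "real^3"
  assumes indep: "\<And>\<alpha> \<beta>. \<alpha> *\<^sub>R p + \<beta> *\<^sub>R q = 0 \<Longrightarrow> \<alpha> = 0 \<and> \<beta> = 0"
  obtains A a \<alpha> \<beta> where "A \<in> SO3" "a \<ge> 0" "\<alpha> > 0" "\<beta> > 0"
    "A *v p = vector [\<alpha>, \<alpha> * a, 0]" "A *v q = vector [-\<beta>, \<beta> * a, 0]"
proof -
  have p: "p \<noteq> 0" using indep[of 1 0] by auto
  have q: "q \<noteq> 0" using indep[of 0 1] by auto
  define p' q' where "p' = p /\<^sub>R norm p" and "q' = q /\<^sub>R norm q"
  define w1 w2 where "w1 = p' - q'" and "w2 = p' + q'"
  have n: "p' \<bullet> p' = 1" "q' \<bullet> q' = 1" using p q by (simp_all add: p'_def q'_def dot_square_norm power2_eq_square)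
  have w1: "w1 \<noteq> 0"
    using indep[of "inverse (norm p)" "- inverse (norm q)"] p by (auto simp: w1_def p'_def q'_def)
  have w2: "w2 \<noteq> 0"
    using indep[of "inverse (norm p)" "inverse (norm q)"] p by (auto simp: w2_def p'_def q'_def)
  have ortho: "w1 \<bullet> w2 = 0" using n by (simp add: w1_def w2_def inner_diff_left inner_diff_right inner_add_left inner_add_right inner_commute)
  define e1 e2 where "e1 = w1 /\<^sub>R norm w1" and "e2 = w2 /\<^sub>R norm w2"
  \<comment> \<open>The cross product completes the frame with positive orientation, so that the
    determinant is 1 and not -1.\<close>
  define e3 where "e3 = cross3 e1 e2"
  have e: "e1 \<bullet> e1 = 1" "e2 \<bullet> e2 = 1" "e1 \<bullet> e2 = 0" "e2 \<bullet> e1 = 0"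
    using w1 w2 ortho by (simp_all add: e1_def e2_def dot_square_norm power2_eq_square inner_commute)
  have "e1 \<bullet> e3 = 0" "e2 \<bullet> e3 = 0"
    by (simp_all add: e3_def dot_cross_self)
  moreover have "e3 \<bullet> e3 = 1"
    using norm_cross_dot[of e1 e2] e by (simp add: e3_def dot_square_norm power_mult_distrib)
  ultimately have e': "e1 \<bullet> e3 = 0" "e2 \<bullet> e3 = 0" "e3 \<bullet> e1 = 0" "e3 \<bullet> e2 = 0" "e3 \<bullet> e3 = 1"
    by (simp_all add: inner_commute)
  define A :: "real^3^3" where "A = vector [e1, e2, e3]"
  have A: "A *v x = vector [e1 \<bullet> x, e2 \<bullet> x, e3 \<bullet> x]" for x
    by (simp add: vec_eq_iff forall_3 A_def matrix_vector_mul_component)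
  have "orthogonal_matrix A"
    unfolding orthogonal_matrix_orthonormal_rows
    using e e' by (simp add: forall_3 row_def A_def norm_eq_1 orthogonal_def)
  moreover have "det A = 1"
  proof -
    have "det A = e1 \<bullet> cross3 e2 e3" by (simp add: dot_cross_det A_def)
    also have "\<dots> = e3 \<bullet> cross3 e1 e2" by (simp add: cross3_simps)
    finally show ?thesis using e' by (simp add: e3_def)
  qed
  ultimately have SO: "A \<in> SO3" by (simp add: SO3_def)
  have ws: "e1 \<bullet> w1 = norm w1" "e2 \<bullet> w2 = norm w2" "e1 \<bullet> w2 = 0" "e2 \<bullet> w1 = 0" "e3 \<bullet> w1 = 0" "e3 \<bullet> w2 = 0"
  proof -
    show "e1 \<bullet> w1 = norm w1" "e2 \<bullet> w2 = norm w2" "e1 \<bullet> w2 = 0" "e2 \<bullet> w1 = 0"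
      using w1 w2 ortho by (simp_all add: e1_def e2_def dot_square_norm power2_eq_square inner_commute)
    have "w1 = norm w1 *\<^sub>R e1" "w2 = norm w2 *\<^sub>R e2" using w1 w2 by (simp_all add: e1_def e2_def)
    then show "e3 \<bullet> w1 = 0" "e3 \<bullet> w2 = 0" using e' by (metis inner_scaleR_right mult_zero_right)+
  qed
  \<comment> \<open>\<open>a\<close> is the cotangent of half the angle between \<open>p\<close> and
    \<open>q\<close>. The factors 1/2 come from p' = (w1 + w2)/2 and q' = (w2 - w1)/2.\<close>
  define a \<alpha> \<beta> where "a = norm w2 / norm w1" and "\<alpha> = norm p * norm w1 / 2" and "\<beta> = norm q * norm w1 / 2"
  have "2 *\<^sub>R p' = w1 + w2" by (simp add: w1_def w2_def scaleR_2)
  moreover have "p = (norm p / 2) *\<^sub>R 2 *\<^sub>R p'" using p by (simp add: p'_def)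
  ultimately have pw: "p = (norm p / 2) *\<^sub>R (w1 + w2)" by simp
  have "2 *\<^sub>R q' = w2 - w1" by (simp add: w1_def w2_def scaleR_2)
  moreover have "q = (norm q / 2) *\<^sub>R 2 *\<^sub>R q'" using q by (simp add: q'_def)
  ultimately have qw: "q = (norm q / 2) *\<^sub>R (w2 - w1)" by simp
  have "A *v p = vector [\<alpha>, \<alpha> * a, 0]"
    unfolding A by (subst (1 2 3) pw) (use w1 in \<open>simp add: inner_add_right ws \<alpha>_def a_def\<close>)
  moreover have "A *v q = vector [-\<beta>, \<beta> * a, 0]"
    unfolding A by (subst (1 2 3) qw) (use w1 in \<open>simp add: inner_diff_right ws \<beta>_def a_def\<close>)
  moreover have "a \<ge> 0" "\<alpha> > 0" "\<beta> > 0"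
    using p q w1 by (auto simp: a_def \<alpha>_def \<beta>_def)
  ultimately show thesis using that SO by blast
qed

lemma partials_cong:
  assumes "open U" "x \<in> U" "\<And>y. y \<in> U \<Longrightarrow> g y = h y" "g differentiable (at x)"
  shows "partial_u h x = partial_u g x" "partial_v h x = partial_v g x"
proof -
  have "(h has_derivative frechet_derivative g (at x)) (at x)"
    by (rule has_derivative_transform_within_open[OF differentiable_has_frechet_derivative[OF assms(4)] assms(1,2)])
      (use assms in auto)
  then show "partial_u h x = partial_u g x" "partial_v h x = partial_v g x"
    using partials_from_derivative by (simp_all add: partial_u_def partial_v_def frechet_derivative_at)
qed

lemma partials_bounded_linear:
  assumes "bounded_linear L" "g differentiable (at x)"
  shows "partial_u (\<lambda>x. L (g x)) x = L (partial_u g x)" "partial_v (\<lambda>x. L (g x)) x = L (partial_v g x)"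
  using partials_from_derivative[OF bounded_linear.has_derivative[OF assms(1)
      differentiable_has_frechet_derivative[OF assms(2)]]]
  by (simp_all add: partial_u_def partial_v_def)

text \<open>The last two conclusions keep the exact shape of \<open>s\<close> on the axes, where the
  mixed term disappears; they later determine the quadratic coefficients in the new
  coordinates.\<close>

lemma normal_coordinates:
  assumes e: "0 < e" and p: "smooth_on {-e<..<e} p" and q: "smooth_on {-e<..<e} q" and r: "smooth_on (square e) r"
    and F: "\<And>u v. (u, v) \<in> square e \<Longrightarrow> F (u, v) = u\<^sup>2 * p u + v\<^sup>2 * q v + u\<^sup>2 * v\<^sup>2 * r (u, v)"
    and p0: "p 0 > 0" and q0: "q 0 < (0::real)"
  obtains e' U s t where "0 < e'" "U \<subseteq> square e" "diffeo0 U (square e') s t"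
    "\<And>x. x \<in> U \<Longrightarrow> F x = (fst (s x))\<^sup>2 - (snd (s x))\<^sup>2"
    "\<And>h. smooth_on (square e) h \<Longrightarrow> axis_critical e h \<Longrightarrow> axis_critical e' (\<lambda>y. h (t y))"
    "\<And>u. (u, 0) \<in> U \<Longrightarrow> p u > 0 \<and> s (u, 0) = (u * sqrt (p u), 0)"
    "\<And>v. (0, v) \<in> U \<Longrightarrow> q v < 0 \<and> s (0, v) = (0, v * sqrt (- q v))"
proof -
  define \<sigma> where "\<sigma> x = p (fst x) + (snd x)\<^sup>2 * r x" for x
  define \<tau> where "\<tau> x = - q (snd x)" for x :: "real \<times> real"
  \<comment> \<open>Both radicands must be strictly positive, since the root is smooth only
    there.\<close>
  define \<Omega> where "\<Omega> = {x \<in> square e. \<sigma> x > 0 \<and> \<tau> x > 0}"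
  define s1 where "s1 x = fst x * sqrt (\<sigma> x)" for x
  define s2 where "s2 x = snd x * sqrt (\<tau> x)" for x
  define s where "s x = (s1 x, s2 x)" for x
  have \<sigma>: "smooth_on (square e) \<sigma>" and \<tau>: "smooth_on (square e) \<tau>"
    unfolding \<sigma>_def[abs_def] \<tau>_def[abs_def]
    by (intro smooth_on_add smooth_on_minus smooth_on_mult smooth_on_power smooth_on_snd smooth_on_ident
        smooth_on_real_fst smooth_on_real_snd p q r open_square)+
  have "\<Omega> = (square e \<inter> \<sigma> -` {0<..}) \<inter> (square e \<inter> \<tau> -` {0<..})" by (auto simp: \<Omega>_def)
  moreover have "open \<dots>"
    by (intro open_Int continuous_open_preimage smooth_on_continuous[OF \<sigma>] smooth_on_continuous[OF \<tau>] open_square open_greaterThan)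
  ultimately have \<Omega>: "open \<Omega>" by simp
  have sub: "\<Omega> \<subseteq> square e" by (auto simp: \<Omega>_def)
  have \<Omega>0: "(0, 0) \<in> \<Omega>" using e p0 q0 by (simp add: \<Omega>_def in_square_iff \<sigma>_def \<tau>_def)
  have s1: "smooth_on \<Omega> s1" and s2: "smooth_on \<Omega> s2"
    unfolding s1_def[abs_def] s2_def[abs_def]
    by (intro smooth_on_mult smooth_on_sqrt smooth_on_fst smooth_on_snd smooth_on_ident \<Omega>
        smooth_on_subset[OF \<sigma> sub] smooth_on_subset[OF \<tau> sub]; simp add: \<Omega>_def)+
  have s: "smooth_on \<Omega> s"
    unfolding s_def[abs_def] by (intro smooth_on_Pair \<Omega> s1 s2)
  have comp: "fst (partial_u s x) = partial_u s1 x" "fst (partial_v s x) = partial_v s1 x"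
      "snd (partial_u s x) = partial_u s2 x" "snd (partial_v s x) = partial_v s2 x" if "x \<in> \<Omega>" for x
    using partials_bounded_linear[OF bounded_linear_fst smooth_on_differentiable[OF s that]]
      partials_bounded_linear[OF bounded_linear_snd smooth_on_differentiable[OF s that]]
    by (simp_all add: s_def)
  have s2u: "partial_u s2 x = 0" if "x \<in> \<Omega>" for x
  proof (cases x)
    case (Pair u v)
    show ?thesis
      unfolding Pair using that by (intro partial_u_real_eqI[OF s2]) (auto simp: Pair s2_def \<tau>_def)
  qed
  \<comment> \<open>The radicand is p(u) plus a multiple of \<open>v^2\<close>, so its derivative in
    v vanishes at v = 0.\<close>
  have s1v: "partial_v s1 (u, 0) = 0" if u: "(u, 0) \<in> \<Omega>" for u
  proof (rule partial_v_real_eqI[OF s1 u])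
    have sq: "(u, 0) \<in> square e" and pos: "\<sigma> (u, 0) > 0" using u by (auto simp: \<Omega>_def)
    have "((\<lambda>y. p u + y\<^sup>2 * r (u, y)) has_field_derivative 0) (at 0)"
      using partial_v_real_derivative[OF r sq] by (auto intro!: derivative_eq_intros)
    then have d: "((\<lambda>y. \<sigma> (u, y)) has_field_derivative 0) (at 0)" by (simp add: \<sigma>_def)
    have "((\<lambda>y. sqrt (\<sigma> (u, y))) has_field_derivative inverse (sqrt (\<sigma> (u, 0))) / 2 * 0) (at 0)"
      by (rule DERIV_chain2[OF DERIV_real_sqrt[OF pos] d])
    then have "((\<lambda>y. u * sqrt (\<sigma> (u, y))) has_field_derivative u * (inverse (sqrt (\<sigma> (u, 0))) / 2 * 0)) (at 0)"
      by (rule DERIV_cmult)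
    then show "((\<lambda>y. s1 (u, y)) has_field_derivative 0) (at 0)" by (simp add: s1_def)
  qed
  have prod0: "((\<lambda>x. x * sqrt (f x)) has_field_derivative sqrt (f 0)) (at 0)"
    if f: "smooth_on {-e<..<e} f" and "f 0 > 0" for f
  proof -
    have "(f has_field_derivative frechet_derivative f (at 0) 1) (at 0)"
      by (rule smooth_on_real_has_derivative[OF f]) (use e in auto)
    from DERIV_mult[OF DERIV_ident DERIV_chain2[OF DERIV_real_sqrt[OF \<open>f 0 > 0\<close>] this]]
    show ?thesis by simp
  qed
  have "partial_u s1 (0, 0) = sqrt (p 0)"
    by (rule partial_u_real_eqI[OF s1 \<Omega>0]) (use prod0[OF p p0] in \<open>simp add: s1_def \<sigma>_def\<close>)
  moreover have "partial_v s2 (0, 0) = sqrt (- q 0)"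
    by (rule partial_v_real_eqI[OF s2 \<Omega>0])
      (use prod0[OF smooth_on_minus[OF _ q]] q0 in \<open>simp add: s2_def \<tau>_def\<close>)
  ultimately have "jac_det s 0 \<noteq> 0"
    using p0 q0 s2u[OF \<Omega>0] comp[OF \<Omega>0] by (simp add: jac_det_partials zero_prod_def)
  then obtain U0 V0 t where U0: "U0 \<subseteq> \<Omega>" "diffeo0 U0 V0 s t"
    using smooth_inverse_function[OF \<Omega> s] \<Omega>0 by (auto simp: zero_prod_def s_def s1_def s2_def)
  then have "open V0" "0 \<in> V0" by (auto simp: diffeo0_def)
  then obtain e' where e': "e' > 0" "square e' \<subseteq> V0" using open_contains_square by blast
  \<comment> \<open>The domain is cut down so that the image is again a square, on which the
    decomposition can be repeated.\<close>
  define U where "U = t ` square e'"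
  have D: "diffeo0 U (square e') s t"
    unfolding U_def
    by (rule diffeo0_restrict_range[OF U0(2) open_square e'(2)]) (use e'(1) in \<open>simp add: zero_prod_def in_square_iff\<close>)
  have "U \<subseteq> U0" using U0(2) e'(2) by (auto simp: U_def diffeo0_def)
  then have U: "U \<subseteq> \<Omega>" using U0(1) by blast
  have "open U" and tin: "\<And>y. y \<in> square e' \<Longrightarrow> t y \<in> U" and st: "\<And>y. y \<in> square e' \<Longrightarrow> s (t y) = y"
    and ts: "\<And>x. x \<in> U \<Longrightarrow> t (s x) = x" and smt: "smooth_on (square e') t"
    using D by (auto simp: diffeo0_def)
  show thesis
  proof (rule that[OF e'(1) _ D])
    show "U \<subseteq> square e" using U sub by blast
    show "F x = (fst (s x))\<^sup>2 - (snd (s x))\<^sup>2" if "x \<in> U" for x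
    proof (cases x)
      case (Pair u v)
      then have "(u, v) \<in> \<Omega>" using U that by blast
      then have "(u, v) \<in> square e" "\<sigma> (u, v) > 0" "\<tau> (u, v) > 0" by (auto simp: \<Omega>_def)
      then show ?thesis
        by (simp add: Pair F s_def s1_def s2_def power_mult_distrib) (simp add: \<sigma>_def \<tau>_def algebra_simps)
    qed
    show "p u > 0 \<and> s (u, 0) = (u * sqrt (p u), 0)" if "(u, 0) \<in> U" for u
      using that U by (auto simp: \<Omega>_def \<sigma>_def s_def s1_def s2_def)
    show "q v < 0 \<and> s (0, v) = (0, v * sqrt (- q v))" if "(0, v) \<in> U" for v
      using that U by (auto simp: \<Omega>_def \<tau>_def s_def s1_def s2_def)
    fix h :: "real \<times> real \<Rightarrow> real" assume h: "smooth_on (square e) h" and crit: "axis_critical e h"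
    define k where "k y = h (t y)" for y
    have k: "smooth_on (square e') k"
      unfolding k_def[abs_def] by (rule smooth_on_compose[OF open_square smt h]) (use tin U sub in blast)
    \<comment> \<open>The derivative of the inverse \<open>t\<close> is avoided: the chain rule is
      applied to h = k o s. Its Jacobian matrix is triangular with nonzero determinant, so the
      diagonal factors are nonzero and can be cancelled.\<close>
    have chain: "partial_u h (t y) = partial_u s1 (t y) * partial_u k y"
      "partial_v h (t y) = partial_v s1 (t y) * partial_u k y + partial_v s2 (t y) * partial_v k y"
      "jac_det s (t y) = partial_u s1 (t y) * partial_v s2 (t y)" "jac_det s (t y) \<noteq> 0"
      if y: "y \<in> square e'" for y
    proof -
      have x: "t y \<in> U" "t y \<in> \<Omega>" using tin[OF y] U by auto
      have kd: "k differentiable (at (s (t y)))"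
        using st[OF y] y smooth_on_differentiable[OF k] by simp
      have sd: "s differentiable (at (t y))" by (rule smooth_on_differentiable[OF s x(2)])
      have d: "(\<lambda>x. k (s x)) differentiable (at (t y))"
        using differentiable_compose[OF kd sd] .
      have eq: "k (s x) = h x" if "x \<in> U" for x using ts[OF that] by (simp add: k_def)
      show "partial_u h (t y) = partial_u s1 (t y) * partial_u k y"
        "partial_v h (t y) = partial_v s1 (t y) * partial_u k y + partial_v s2 (t y) * partial_v k y"
        using partials_cong[OF \<open>open U\<close> x(1) eq d] partials_compose[OF sd kd] st[OF y] comp[OF x(2)] s2u[OF x(2)]
        by simp_all
      show "jac_det s (t y) = partial_u s1 (t y) * partial_v s2 (t y)"
        using comp[OF x(2)] s2u[OF x(2)] by (simp add: jac_det_partials)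
      show "jac_det s (t y) \<noteq> 0" by (rule diffeo0_jac_det_nonzero[OF D x(1)])
    qed
    show "axis_critical e' (\<lambda>y. h (t y))"
      unfolding axis_critical_def k_def[symmetric]
    proof (intro allI impI conjI)
      fix w assume w: "\<bar>w\<bar> < e'"
      have y: "(0, w) \<in> square e'" "(w, 0) \<in> square e'" using w e' by (auto simp: in_square_iff)
      have x: "t (0, w) \<in> \<Omega>" "t (w, 0) \<in> \<Omega>" using tin y U by auto
      \<comment> \<open>The root is positive, so the first new coordinate vanishes only if the first
        old one does; the preimage of the axis lies on the axis.\<close>
      have "fst (t (0, w)) = 0"
        using st[OF y(1)] x(1) by (simp add: s_def s1_def \<Omega>_def)
      then obtain v where v: "t (0, w) = (0, v)" by (cases "t (0, w)") auto
      then have "\<bar>v\<bar> < e" using x(1) sub by (auto simp: in_square_iff)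
      then have "partial_u h (t (0, w)) = 0" using crit v by (simp add: axis_critical_def)
      then show "partial_u k (0, w) = 0" using chain[OF y(1)] by auto
      have "snd (t (w, 0)) = 0"
        using st[OF y(2)] x(2) by (simp add: s_def s2_def \<Omega>_def)
      then obtain u where u: "t (w, 0) = (u, 0)" by (cases "t (w, 0)") auto
      then have "\<bar>u\<bar> < e" using x(2) sub by (auto simp: in_square_iff)
      then have "partial_v h (t (w, 0)) = 0" using crit u by (simp add: axis_critical_def)
      moreover have "partial_v s1 (t (w, 0)) = 0" using s1v x(2) u by simp
      ultimately show "partial_v k (w, 0) = 0" using chain[OF y(2)] by auto
    qed
  qed
qed

section \<open>Normal form and its symmetries\<close>

lemma quadratic_coefficient_fst:
  assumes F: "smooth_on (square e) F" and "0 < e"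
    and p: "smooth_on {-e<..<e} p"
    and dec: "\<And>u. \<bar>u\<bar> < e \<Longrightarrow> F (u, 0) = u\<^sup>2 * p u"
    and \<phi>: "continuous_on {-e<..<e} \<phi>" and der: "\<And>u. \<bar>u\<bar> < e \<Longrightarrow> partial_u F (u, 0) = u * \<phi> u"
  shows "\<phi> 0 = 2 * p 0"
proof (rule quadratic_coefficient[OF p \<open>0 < e\<close> \<phi>])
  fix u assume u: "\<bar>u\<bar> < e"
  have "((\<lambda>x. F (x, 0)) has_field_derivative u * \<phi> u) (at u)"
    using partial_u_real_derivative[OF F, of u 0] der[OF u] u \<open>0 < e\<close> by (simp add: in_square_iff)
  then show "((\<lambda>u. u\<^sup>2 * p u) has_field_derivative u * \<phi> u) (at u)"
    by (rule has_field_derivative_transform_within_open[of _ _ _ "{-e<..<e}"]) (use u dec in auto)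
qed

lemma quadratic_coefficient_snd:
  assumes F: "smooth_on (square e) F" and "0 < e"
    and q: "smooth_on {-e<..<e} q"
    and dec: "\<And>v. \<bar>v\<bar> < e \<Longrightarrow> F (0, v) = v\<^sup>2 * q v"
    and \<phi>: "continuous_on {-e<..<e} \<phi>" and der: "\<And>v. \<bar>v\<bar> < e \<Longrightarrow> partial_v F (0, v) = v * \<phi> v"
  shows "\<phi> 0 = 2 * q 0"
proof (rule quadratic_coefficient[OF q \<open>0 < e\<close> \<phi>])
  fix v assume v: "\<bar>v\<bar> < e"
  have "((\<lambda>y. F (0, y)) has_field_derivative v * \<phi> v) (at v)"
    using partial_v_real_derivative[OF F, of 0 v] der[OF v] v \<open>0 < e\<close> by (simp add: in_square_iff)
  then show "((\<lambda>v. v\<^sup>2 * q v) has_field_derivative v * \<phi> v) (at v)"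
    by (rule has_field_derivative_transform_within_open[of _ _ _ "{-e<..<e}"]) (use v dec in auto)
qed

text \<open>Under the substitution of u * sqrt(\<rho> u) for u, a quadratic coefficient is divided
  by \<rho>(0): cancel \<open>u^2\<close> away from 0 and pass to the limit.\<close>

lemma quadratic_coefficient_rescale:
  assumes "0 < d" "continuous_on {-d<..<d} \<rho>" "continuous_on {-d<..<d} P" "continuous_on {-e<..<e} P'"
    and eq: "\<And>u. \<bar>u\<bar> < d \<Longrightarrow> \<rho> u > 0 \<and> \<bar>u * sqrt (\<rho> u)\<bar> < e \<and>
      (u * sqrt (\<rho> u))\<^sup>2 * P' (u * sqrt (\<rho> u)) = u\<^sup>2 * P u"
  shows "\<rho> 0 * P' 0 = P 0"
proof -
  have "\<rho> 0 * P' (0 * sqrt (\<rho> 0)) - P 0 = 0"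
  proof (rule continuous_on_eq_at_0[of d "\<lambda>u. \<rho> u * P' (u * sqrt (\<rho> u)) - P u", OF _ assms(1)])
    have "continuous_on {-d<..<d} (\<lambda>u. P' (u * sqrt (\<rho> u)))"
      by (rule continuous_on_compose2[OF assms(4)]) (use eq in \<open>auto intro!: continuous_intros assms(2) simp: abs_less_iff minus_less_iff\<close>)
    then show "continuous_on {-d<..<d} (\<lambda>u. \<rho> u * P' (u * sqrt (\<rho> u)) - P u)"
      by (intro continuous_intros assms(2,3))
    fix u :: real assume u: "u \<noteq> 0" "\<bar>u\<bar> < d"
    then have "u\<^sup>2 * (\<rho> u * P' (u * sqrt (\<rho> u))) = u\<^sup>2 * P u"
      using eq[OF u(2)] by (auto simp: power_mult_distrib)
    then show "\<rho> u * P' (u * sqrt (\<rho> u)) - P u = 0" using u(1) by simp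
  qed
  then show ?thesis by simp
qed

text \<open>The parameters are the data that the symmetries below change, free of sign conditions;
  \<open>a\<close> is listed too, though every symmetry fixes it.\<close>

definition normal_form :: "(real \<times> real \<Rightarrow> real^3) \<Rightarrow> real \<Rightarrow> real \<Rightarrow> real \<Rightarrow> real \<Rightarrow> bool" where
  "normal_form f a \<gamma>1 \<gamma>3 \<omega> \<longleftrightarrow>
    (\<exists>b1 b3 c1 c3 b2 c2 U V s t A.
      smooth_germ0 b1 \<and> smooth_germ0 b3 \<and> smooth_germ0 c1 \<and> smooth_germ0 c3 \<and>
      smooth_germ0 b2 \<and> smooth_germ0 c2 \<and> diffeo0 U V s t \<and> A \<in> SO3 \<and>
      (\<forall>u v. (u, v) \<in> V \<longrightarrow> A *v f (t (u,v)) =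
         vector [u^2 - v^2,
                 a * (u^2 + v^2) + u^3 * b1 u + u^2 * v^2 * b2 (u,v) + v^3 * b3 v,
                 u^3 * c1 u + u^2 * v^2 * c2 (u,v) + v^3 * c3 v]) \<and>
      c1 0 = \<gamma>1 \<and> c3 0 = \<gamma>3 \<and> jac_det s 0 = \<omega>)"

lemma normal_formI:
  assumes "smooth_germ0 b1" "smooth_germ0 b3" "smooth_germ0 c1" "smooth_germ0 c3" "smooth_germ0 b2" "smooth_germ0 c2"
    and "diffeo0 U V s t" "A \<in> SO3"
    and "\<And>u v. (u, v) \<in> V \<Longrightarrow> A *v f (t (u,v)) =
         vector [u^2 - v^2,
                 a * (u^2 + v^2) + u^3 * b1 u + u^2 * v^2 * b2 (u,v) + v^3 * b3 v,
                 u^3 * c1 u + u^2 * v^2 * c2 (u,v) + v^3 * c3 v]"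
    and "c1 0 = \<gamma>1" "c3 0 = \<gamma>3" "jac_det s 0 = \<omega>"
  shows "normal_form f a \<gamma>1 \<gamma>3 \<omega>"
  unfolding normal_form_def using assms by blast

section \<open>Linear involutions of the source\<close>

lemma smooth_germ0_bounded_linear_compose:
  fixes L :: "'a::euclidean_space \<Rightarrow> 'b::euclidean_space"
  assumes "smooth_germ0 g" "bounded_linear L"
  shows "smooth_germ0 (\<lambda>x. g (L x))"
proof -
  obtain U where U: "open U" "0 \<in> U" "smooth_on U g" using assms(1) by (auto simp: smooth_germ0_def)
  have o: "open (L -` U)"
    by (rule continuous_open_vimage[OF U(1) linear_continuous_at[OF assms(2)]])
  moreover have "0 \<in> L -` U" using U(2) linear_0[OF bounded_linear.linear[OF assms(2)]] by simp
  moreover have "smooth_on (L -` U) (\<lambda>x. g (L x))"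
    by (rule smooth_on_compose[OF o smooth_on_bounded_linear[OF o assms(2)] U(3)]) auto
  ultimately show ?thesis unfolding smooth_germ0_def by blast
qed

lemma smooth_germ0_minus: "smooth_germ0 g \<Longrightarrow> smooth_germ0 (\<lambda>x. - g x)"
  unfolding smooth_germ0_def using smooth_on_minus by blast

lemma diffeo0_involution_compose:
  assumes "diffeo0 U V s t" "bounded_linear L" "\<And>x. L (L x) = x"
  shows "diffeo0 U (L ` V) (\<lambda>x. L (s x)) (\<lambda>y. t (L y))"
proof (rule diffeo0_compose[OF assms(1)])
  have V: "open V" "0 \<in> V" using assms(1) by (auto simp: diffeo0_def)
  have "L ` V = L -` V"
  proof
    show "L -` V \<subseteq> L ` V" by (metis assms(3) image_eqI subsetI vimageE)
  qed (auto simp: assms(3))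
  then have "open (L ` V)"
    using continuous_open_vimage[OF V(1) linear_continuous_at[OF assms(2)]] by simp
  moreover have "L 0 = 0" using linear_0[OF bounded_linear.linear[OF assms(2)]] .
  ultimately show "diffeo0 V (L ` V) L L"
    using V assms(2,3) by (auto simp: diffeo0_def image_image intro: smooth_on_bounded_linear)
qed

lemma jac_det_linear_compose:
  assumes "s differentiable (at x)" "bounded_linear L"
  shows "jac_det (\<lambda>x. L (s x)) x = (fst (L (1, 0)) * snd (L (0, 1)) - snd (L (1, 0)) * fst (L (0, 1))) * jac_det s x"
  using jac_det_compose[OF assms(1) bounded_linear_imp_differentiable[OF assms(2)]]
    partials_from_derivative[OF bounded_linear_imp_has_derivative[OF assms(2)]]
  by (simp add: jac_det_partials)

text \<open>Replacing u by -u affects only the odd power \<open>u^3\<close>; the sign is absorbed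
  into \<open>b1\<close> and \<open>c1\<close>, and the rotation stays the same.\<close>

lemma normal_form_reflect_fst:
  assumes "normal_form f a \<gamma>1 \<gamma>3 \<omega>"
  shows "normal_form f a (- \<gamma>1) \<gamma>3 (- \<omega>)"
proof -
  obtain b1 b3 c1 c3 b2 c2 U V s t A where H:
    "smooth_germ0 b1" "smooth_germ0 b3" "smooth_germ0 c1" "smooth_germ0 c3"
    "smooth_germ0 b2" "smooth_germ0 c2" and D: "diffeo0 U V s t" and A: "A \<in> SO3"
    and eq: "\<And>u v. (u, v) \<in> V \<Longrightarrow> A *v f (t (u,v)) =
         vector [u^2 - v^2,
                 a * (u^2 + v^2) + u^3 * b1 u + u^2 * v^2 * b2 (u,v) + v^3 * b3 v,
                 u^3 * c1 u + u^2 * v^2 * c2 (u,v) + v^3 * c3 v]"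
    and v: "c1 0 = \<gamma>1" "c3 0 = \<gamma>3" "jac_det s 0 = \<omega>"
    using assms unfolding normal_form_def by blast
  define L :: "real \<times> real \<Rightarrow> real \<times> real" where "L x = (- fst x, snd x)" for x
  have L: "bounded_linear L" "\<And>x. L (L x) = x"
    unfolding L_def[abs_def]
    by (auto intro!: bounded_linear_Pair bounded_linear_minus bounded_linear_fst bounded_linear_snd)
  have "s differentiable (at 0)" using D smooth_on_differentiable by (auto simp: diffeo0_def)
  from jac_det_linear_compose[OF this L(1)] have j: "jac_det (\<lambda>x. L (s x)) 0 = - \<omega>"
    using v by (simp add: L_def)
  note neg = smooth_germ0_bounded_linear_compose[OF _ bounded_linear_minus[OF bounded_linear_ident]]
  show ?thesis
  proof (rule normal_formI[of "\<lambda>u. - b1 (- u)" b3 "\<lambda>u. - c1 (- u)" c3 "\<lambda>x. b2 (L x)" "\<lambda>x. c2 (L x)"])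
    show "diffeo0 U (L ` V) (\<lambda>x. L (s x)) (\<lambda>y. t (L y))"
      by (rule diffeo0_involution_compose[OF D L])
    show "smooth_germ0 (\<lambda>u. - b1 (- u))" "smooth_germ0 (\<lambda>u. - c1 (- u))"
      "smooth_germ0 (\<lambda>x. b2 (L x))" "smooth_germ0 (\<lambda>x. c2 (L x))"
      by (intro smooth_germ0_minus smooth_germ0_bounded_linear_compose[OF _ L(1)] neg H)+
    show "A *v f (t (L (u, v))) = vector [u^2 - v^2,
       a * (u^2 + v^2) + u^3 * (- b1 (- u)) + u^2 * v^2 * b2 (L (u,v)) + v^3 * b3 v,
       u^3 * (- c1 (- u)) + u^2 * v^2 * c2 (L (u,v)) + v^3 * c3 v]" if "(u, v) \<in> L ` V" for u v
    proof -
      have "(- u, v) \<in> V" using that by (auto simp: L_def)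
      from eq[OF this] show ?thesis by (simp add: L_def)
    qed
  qed (use H A v j in auto)
qed

lemma normal_form_reflect_snd:
  assumes "normal_form f a \<gamma>1 \<gamma>3 \<omega>"
  shows "normal_form f a \<gamma>1 (- \<gamma>3) (- \<omega>)"
proof -
  obtain b1 b3 c1 c3 b2 c2 U V s t A where H:
    "smooth_germ0 b1" "smooth_germ0 b3" "smooth_germ0 c1" "smooth_germ0 c3"
    "smooth_germ0 b2" "smooth_germ0 c2" and D: "diffeo0 U V s t" and A: "A \<in> SO3"
    and eq: "\<And>u v. (u, v) \<in> V \<Longrightarrow> A *v f (t (u,v)) =
         vector [u^2 - v^2,
                 a * (u^2 + v^2) + u^3 * b1 u + u^2 * v^2 * b2 (u,v) + v^3 * b3 v,
                 u^3 * c1 u + u^2 * v^2 * c2 (u,v) + v^3 * c3 v]"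
    and v: "c1 0 = \<gamma>1" "c3 0 = \<gamma>3" "jac_det s 0 = \<omega>"
    using assms unfolding normal_form_def by blast
  define L :: "real \<times> real \<Rightarrow> real \<times> real" where "L x = (fst x, - snd x)" for x
  have L: "bounded_linear L" "\<And>x. L (L x) = x"
    unfolding L_def[abs_def]
    by (auto intro!: bounded_linear_Pair bounded_linear_minus bounded_linear_fst bounded_linear_snd)
  have "s differentiable (at 0)" using D smooth_on_differentiable by (auto simp: diffeo0_def)
  from jac_det_linear_compose[OF this L(1)] have j: "jac_det (\<lambda>x. L (s x)) 0 = - \<omega>"
    using v by (simp add: L_def)
  note neg = smooth_germ0_bounded_linear_compose[OF _ bounded_linear_minus[OF bounded_linear_ident]]
  show ?thesis
  proof (rule normal_formI[of b1 "\<lambda>u. - b3 (- u)" c1 "\<lambda>u. - c3 (- u)" "\<lambda>x. b2 (L x)" "\<lambda>x. c2 (L x)"])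
    show "diffeo0 U (L ` V) (\<lambda>x. L (s x)) (\<lambda>y. t (L y))"
      by (rule diffeo0_involution_compose[OF D L])
    show "smooth_germ0 (\<lambda>u. - b3 (- u))" "smooth_germ0 (\<lambda>u. - c3 (- u))"
      "smooth_germ0 (\<lambda>x. b2 (L x))" "smooth_germ0 (\<lambda>x. c2 (L x))"
      by (intro smooth_germ0_minus smooth_germ0_bounded_linear_compose[OF _ L(1)] neg H)+
    show "A *v f (t (L (u, v))) = vector [u^2 - v^2,
       a * (u^2 + v^2) + u^3 * b1 u + u^2 * v^2 * b2 (L (u,v)) + v^3 * (- b3 (- v)),
       u^3 * c1 u + u^2 * v^2 * c2 (L (u,v)) + v^3 * (- c3 (- v))]" if "(u, v) \<in> L ` V" for u v
    proof -
      have "(u, - v) \<in> V" using that by (auto simp: L_def)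
      from eq[OF this] show ?thesis by (simp add: L_def)
    qed
  qed (use H A v j in auto)
qed

text \<open>Exchanging the two coordinates negates the first component, which is repaired by the
  half-turn about the second axis; the latter negates the third component as well, and composing the
  exchange with \<open>- id\<close> compensates for this in the cubic terms.\<close>

lemma normal_form_exchange:
  assumes "normal_form f a \<gamma>1 \<gamma>3 \<omega>"
  shows "normal_form f a \<gamma>3 \<gamma>1 (- \<omega>)"
proof -
  obtain b1 b3 c1 c3 b2 c2 U V s t A where H:
    "smooth_germ0 b1" "smooth_germ0 b3" "smooth_germ0 c1" "smooth_germ0 c3"
    "smooth_germ0 b2" "smooth_germ0 c2" and D: "diffeo0 U V s t" and A: "A \<in> SO3"
    and eq: "\<And>u v. (u, v) \<in> V \<Longrightarrow> A *v f (t (u,v)) =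
         vector [u^2 - v^2,
                 a * (u^2 + v^2) + u^3 * b1 u + u^2 * v^2 * b2 (u,v) + v^3 * b3 v,
                 u^3 * c1 u + u^2 * v^2 * c2 (u,v) + v^3 * c3 v]"
    and v: "c1 0 = \<gamma>1" "c3 0 = \<gamma>3" "jac_det s 0 = \<omega>"
    using assms unfolding normal_form_def by blast
  define L :: "real \<times> real \<Rightarrow> real \<times> real" where "L x = (- snd x, - fst x)" for x
  have L: "bounded_linear L" "\<And>x. L (L x) = x"
    unfolding L_def[abs_def]
    by (auto intro!: bounded_linear_Pair bounded_linear_minus bounded_linear_fst bounded_linear_snd)
  have "s differentiable (at 0)" using D smooth_on_differentiable by (auto simp: diffeo0_def)
  from jac_det_linear_compose[OF this L(1)] have j: "jac_det (\<lambda>x. L (s x)) 0 = - \<omega>"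
    using v by (simp add: L_def)
  note neg = smooth_germ0_bounded_linear_compose[OF _ bounded_linear_minus[OF bounded_linear_ident]]
  define R :: "real^3^3" where "R = vector [vector [-1, 0, 0], vector [0, 1, 0], vector [0, 0, -1]]"
  have Rv: "R *v x = vector [- x $ 1, x $ 2, - x $ 3]" for x
    by (simp add: vec_eq_iff forall_3 R_def matrix_vector_mult_def sum_3)
  have "orthogonal_matrix R"
    by (simp add: orthogonal_matrix vec_eq_iff forall_3 R_def matrix_matrix_mult_def transpose_def sum_3 mat_def)
  moreover have "det R = 1" by (simp add: det_3 R_def)
  ultimately have RA: "R ** A \<in> SO3"
    using A by (simp add: SO3_def orthogonal_matrix_mul det_mul)
  show ?thesis
  proof (rule normal_formI[of "\<lambda>u. - b3 (- u)" "\<lambda>u. - b1 (- u)" "\<lambda>u. c3 (- u)" "\<lambda>u. c1 (- u)" "\<lambda>x. b2 (L x)" "\<lambda>x. - c2 (L x)"])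
    show "diffeo0 U (L ` V) (\<lambda>x. L (s x)) (\<lambda>y. t (L y))"
      by (rule diffeo0_involution_compose[OF D L])
    show "smooth_germ0 (\<lambda>u. - b3 (- u))" "smooth_germ0 (\<lambda>u. - b1 (- u))"
      "smooth_germ0 (\<lambda>u. c3 (- u))" "smooth_germ0 (\<lambda>u. c1 (- u))"
      "smooth_germ0 (\<lambda>x. b2 (L x))" "smooth_germ0 (\<lambda>x. - c2 (L x))"
      by (intro smooth_germ0_minus smooth_germ0_bounded_linear_compose[OF _ L(1)] neg H)+
    show "(R ** A) *v f (t (L (u, v))) = vector [u^2 - v^2,
       a * (u^2 + v^2) + u^3 * (- b3 (- u)) + u^2 * v^2 * b2 (L (u,v)) + v^3 * (- b1 (- v)),
       u^3 * c3 (- u) + u^2 * v^2 * (- c2 (L (u,v))) + v^3 * c1 (- v)]" if "(u, v) \<in> L ` V" for u v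
    proof -
      have "(- v, - u) \<in> V" using that by (auto simp: L_def)
      from eq[OF this] show ?thesis
        by (simp add: L_def matrix_vector_mul_assoc[symmetric] Rv algebra_simps)
    qed
  qed (use H RA v j in auto)
qed

text \<open>The order matters. Each reflection corrects one sign but reverses orientation, so signs
  come first. The exchange then restores orientation, because it permutes the two values without
  changing their signs.\<close>

lemma normal_form_nonneg_oriented:
  assumes "normal_form f a \<gamma>1 \<gamma>3 \<omega>" "\<omega> \<noteq> 0"
  obtains \<delta>1 \<delta>3 \<epsilon> where "normal_form f a \<delta>1 \<delta>3 \<epsilon>" "\<delta>1 \<ge> 0" "\<delta>3 \<ge> 0" "\<epsilon> > 0"
proof -
  have "\<exists>\<omega>. normal_form f a \<bar>\<gamma>1\<bar> \<gamma>3 \<omega> \<and> \<omega> \<noteq> 0"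
    using assms normal_form_reflect_fst[OF assms(1)] by (cases "\<gamma>1 \<ge> 0") (auto simp: abs_if)
  then obtain \<omega>1 where 1: "normal_form f a \<bar>\<gamma>1\<bar> \<gamma>3 \<omega>1" "\<omega>1 \<noteq> 0" by blast
  have "\<exists>\<omega>. normal_form f a \<bar>\<gamma>1\<bar> \<bar>\<gamma>3\<bar> \<omega> \<and> \<omega> \<noteq> 0"
    using 1 normal_form_reflect_snd[OF 1(1)] by (cases "\<gamma>3 \<ge> 0") (auto simp: abs_if)
  then obtain \<omega>2 where 2: "normal_form f a \<bar>\<gamma>1\<bar> \<bar>\<gamma>3\<bar> \<omega>2" "\<omega>2 \<noteq> 0" by blast
  show thesis
  proof (cases "\<omega>2 > 0")
    case True
    then show ?thesis using that 2 by auto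
  next
    case False
    then show ?thesis using that[OF normal_form_exchange[OF 2(1)]] 2(2) by auto
  qed
qed

section \<open>Assembly of the normal form\<close>

lemma smooth_germ0I: "open U \<Longrightarrow> 0 \<in> U \<Longrightarrow> smooth_on U g \<Longrightarrow> smooth_germ0 g"
  unfolding smooth_germ0_def by blast

text \<open>One more division by the variable turns \<open>p\<close> and \<open>q\<close> into their
  common value at 0 plus cubic contributions. It serves the second component, and with value 0 the
  third.\<close>

lemma split_quadratic_coefficients:
  assumes e: "0 < e" and D: "smooth_on {-e<..<e} p" "smooth_on {-e<..<e} q" "smooth_on (square e) r"
      "\<And>u v. (u, v) \<in> square e \<Longrightarrow> k (u, v) = u\<^sup>2 * p u + v\<^sup>2 * q v + u\<^sup>2 * v\<^sup>2 * r (u, v)"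
    and 0: "p 0 = a" "q 0 = (a::real)"
  obtains b1 b2 b3 where "smooth_germ0 b1" "smooth_germ0 b2" "smooth_germ0 b3"
    "\<And>u v. (u, v) \<in> square e \<Longrightarrow> k (u, v) = a * (u\<^sup>2 + v\<^sup>2) + u^3 * b1 u + u\<^sup>2 * v\<^sup>2 * b2 (u, v) + v^3 * b3 v"
proof -
  obtain b1 where b1: "smooth_on {-e<..<e} b1" "\<And>u. \<bar>u\<bar> < e \<Longrightarrow> p u = p 0 + u * b1 u"
    using hadamard_real[OF D(1) e] by blast
  obtain b3 where b3: "smooth_on {-e<..<e} b3" "\<And>u. \<bar>u\<bar> < e \<Longrightarrow> q u = q 0 + u * b3 u"
    using hadamard_real[OF D(2) e] by blast
  show thesis
  proof (rule that)
    show "smooth_germ0 b1" "smooth_germ0 b3"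
      using b1(1) b3(1) e by (auto intro: smooth_germ0I[of "{-e<..<e}"])
    show "smooth_germ0 r"
      by (rule smooth_germ0I[OF open_square _ D(3)]) (use e in \<open>simp add: zero_prod_def in_square_iff\<close>)
    fix u v assume uv: "(u, v) \<in> square e"
    then have "p u = a + u * b1 u" "q v = a + v * b3 v" using b1(2) b3(2) 0 by (auto simp: in_square_iff)
    then show "k (u, v) = a * (u\<^sup>2 + v\<^sup>2) + u^3 * b1 u + u\<^sup>2 * v\<^sup>2 * r (u, v) + v^3 * b3 v"
      using D(4)[OF uv] by (simp add: algebra_simps power2_eq_square power3_eq_cube)
  qed
qed

text \<open>The normal form before any adjustment of signs or orientation, relative to the given
  coordinates. Of \<phi>1 and \<phi>2 only continuity is required, since they matter only through
  their values at 0.\<close>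

lemma axis_critical_normal_form:
  fixes g \<phi>1 \<phi>2 :: "real \<times> real \<Rightarrow> real^3"
  assumes e: "0 < e" and g: "smooth_on (square e) g" and g0: "g 0 = 0"
    and \<phi>: "continuous_on (square e) \<phi>1" "continuous_on (square e) \<phi>2"
    and gu: "\<And>u v. (u, v) \<in> square e \<Longrightarrow> partial_u g (u, v) = u *\<^sub>R \<phi>1 (u, v)"
    and gv: "\<And>u v. (u, v) \<in> square e \<Longrightarrow> partial_v g (u, v) = v *\<^sub>R \<phi>2 (u, v)"
    and indep: "\<And>\<alpha> \<beta>. \<alpha> *\<^sub>R \<phi>1 (0,0) + \<beta> *\<^sub>R \<phi>2 (0,0) = 0 \<Longrightarrow> \<alpha> = 0 \<and> \<beta> = 0"
  obtains a b1 b2 b3 c1 c2 c3 U V s t A where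
    "smooth_germ0 b1" "smooth_germ0 b3" "smooth_germ0 c1" "smooth_germ0 c3" "smooth_germ0 b2" "smooth_germ0 c2"
    "U \<subseteq> square e" "diffeo0 U V s t" "A \<in> SO3" "a \<ge> 0"
    "\<And>u v. (u, v) \<in> V \<Longrightarrow> A *v g (t (u,v)) =
         vector [u^2 - v^2,
                 a * (u^2 + v^2) + u^3 * b1 u + u^2 * v^2 * b2 (u,v) + v^3 * b3 v,
                 u^3 * c1 u + u^2 * v^2 * c2 (u,v) + v^3 * c3 v]"
proof -
  obtain A a \<alpha> \<beta> where A: "A \<in> SO3" "a \<ge> 0" "\<alpha> > 0" "\<beta> > 0"
    "A *v \<phi>1 (0,0) = vector [\<alpha>, \<alpha> * a, 0]" "A *v \<phi>2 (0,0) = vector [-\<beta>, \<beta> * a, 0]"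
    using rotation_adapted[OF indep] by blast
  \<comment> \<open>Indexing by the component lets all three share one treatment: the first supplies
    the coordinates, and the others are compared with it.\<close>
  define F where "F i x = (A *v g x) $ i" for i x
  have L: "bounded_linear (\<lambda>w. (A *v w) $ i)" for i
    by (rule bounded_linear_compose[OF bounded_linear_vec_nth matrix_vector_mul_bounded_linear])
  have F: "smooth_on (square e) (F i)" for i
    unfolding F_def[abs_def] by (rule smooth_on_bounded_linear_compose[OF open_square L g])
  have F0: "F i (0, 0) = 0" for i using g0 by (simp add: F_def zero_prod_def)
  have Fu: "partial_u (F i) (u, v) = u * (A *v \<phi>1 (u, v)) $ i" if "(u, v) \<in> square e" for i u v
    using partials_bounded_linear(1)[OF L smooth_on_differentiable[OF g that], of i] gu[OF that]
    by (simp add: F_def[abs_def] matrix_vector_mult_scaleR)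
  have Fv: "partial_v (F i) (u, v) = v * (A *v \<phi>2 (u, v)) $ i" if "(u, v) \<in> square e" for i u v
    using partials_bounded_linear(2)[OF L smooth_on_differentiable[OF g that], of i] gv[OF that]
    by (simp add: F_def[abs_def] matrix_vector_mult_scaleR)
  have crit: "axis_critical e (F i)" for i
    using e by (auto simp: axis_critical_def Fu Fv in_square_iff)
  have "\<exists>p q r. smooth_on {-e<..<e} p \<and> smooth_on {-e<..<e} q \<and> smooth_on (square e) r \<and>
      (\<forall>u v. (u, v) \<in> square e \<longrightarrow> F i (u, v) = u\<^sup>2 * p u + v\<^sup>2 * q v + u\<^sup>2 * v\<^sup>2 * r (u, v))" for i
    using axis_critical_decomposition[OF F e F0 crit, of i] by metis
  then obtain p q r where p: "\<And>i. smooth_on {-e<..<e} (p i)" and q: "\<And>i. smooth_on {-e<..<e} (q i)"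
    and r: "\<And>i. smooth_on (square e) (r i)"
    and dec: "\<And>i u v. (u, v) \<in> square e \<Longrightarrow> F i (u, v) = u\<^sup>2 * p i u + v\<^sup>2 * q i v + u\<^sup>2 * v\<^sup>2 * r i (u, v)"
    by metis
  have Lc: "continuous_on S (\<lambda>u. (A *v h u) $ i)" if "continuous_on S h" for S i and h :: "real \<Rightarrow> real^3"
    by (rule bounded_linear.continuous_on[OF L that])
  have p0: "(A *v \<phi>1 (0, 0)) $ i = 2 * p i 0" for i
  proof (rule quadratic_coefficient_fst[OF F e p, where \<phi> = "\<lambda>u. (A *v \<phi>1 (u, 0)) $ i"])
    show "continuous_on {-e<..<e} (\<lambda>u. (A *v \<phi>1 (u, 0)) $ i)"
      by (intro Lc continuous_on_compose2[OF \<phi>(1)]) (use e in \<open>auto intro!: continuous_intros simp: in_square_iff\<close>)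
  qed (use e in \<open>auto simp: in_square_iff Fu dec\<close>)
  have q0: "(A *v \<phi>2 (0, 0)) $ i = 2 * q i 0" for i
  proof (rule quadratic_coefficient_snd[OF F e q, where \<phi> = "\<lambda>u. (A *v \<phi>2 (0, u)) $ i"])
    show "continuous_on {-e<..<e} (\<lambda>u. (A *v \<phi>2 (0, u)) $ i)"
      by (intro Lc continuous_on_compose2[OF \<phi>(2)]) (use e in \<open>auto intro!: continuous_intros simp: in_square_iff\<close>)
  qed (use e in \<open>auto simp: in_square_iff Fv dec\<close>)
  have pv: "p 1 0 = \<alpha> / 2" "p 2 0 = \<alpha> / 2 * a" "p 3 0 = 0"
    using p0[of 1] p0[of 2] p0[of 3] A(5) by simp_all
  have qv: "q 1 0 = - \<beta> / 2" "q 2 0 = \<beta> / 2 * a" "q 3 0 = 0"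
    using q0[of 1] q0[of 2] q0[of 3] A(6) by simp_all
  have pos: "p 1 0 > 0" "q 1 0 < 0" using pv qv A by simp_all
  obtain e' U s t where N: "0 < e'" "U \<subseteq> square e" "diffeo0 U (square e') s t"
    "\<And>x. x \<in> U \<Longrightarrow> F 1 x = (fst (s x))\<^sup>2 - (snd (s x))\<^sup>2"
    "\<And>h. smooth_on (square e) h \<Longrightarrow> axis_critical e h \<Longrightarrow> axis_critical e' (\<lambda>y. h (t y))"
    "\<And>u. (u, 0) \<in> U \<Longrightarrow> p 1 u > 0 \<and> s (u, 0) = (u * sqrt (p 1 u), 0)"
    "\<And>v. (0, v) \<in> U \<Longrightarrow> q 1 v < 0 \<and> s (0, v) = (0, v * sqrt (- q 1 v))"
    using normal_coordinates[OF e p q r dec pos] by blast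
  have U: "open U" "0 \<in> U" "s 0 = 0" and sU: "\<And>x. x \<in> U \<Longrightarrow> s x \<in> square e'"
    and ts: "\<And>x. x \<in> U \<Longrightarrow> t (s x) = x" and tU: "\<And>y. y \<in> square e' \<Longrightarrow> t y \<in> U"
    and st: "\<And>y. y \<in> square e' \<Longrightarrow> s (t y) = y" and t: "smooth_on (square e') t"
    using N(3) by (auto simp: diffeo0_def)
  \<comment> \<open>On this smaller square both axis segments lie in the domain of \<open>s\<close>,
    so its explicit form there can be used.\<close>
  obtain d where d: "d > 0" "square d \<subseteq> U" using open_contains_square[OF U(1,2)] by blast
  have dU: "(u, 0) \<in> U" "(0, u) \<in> U" "\<bar>u\<bar> < e" if "\<bar>u\<bar> < d" for u
  proof -
    show u: "(u, 0) \<in> U" "(0, u) \<in> U" using d that by (auto simp: in_square_iff)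
    show "\<bar>u\<bar> < e" using u N(2) by (auto simp: in_square_iff)
  qed
  then have de: "{-d<..<d} \<subseteq> {-e<..<e}" by (force simp: abs_less_iff)
  define k where "k i y = F i (t y)" for i y
  have k: "smooth_on (square e') (k i)" for i
    unfolding k_def[abs_def] by (rule smooth_on_compose[OF open_square t F]) (use tU N(2) in blast)
  have k0: "k i (0, 0) = 0" for i
    using ts[OF U(2)] U(3) F0[of i] by (simp add: k_def zero_prod_def)
  have kcrit: "axis_critical e' (k i)" for i
    unfolding k_def[abs_def] by (rule N(5)[OF F crit])
  have ks: "k i (s x) = F i x" if "x \<in> U" for i x using ts[OF that] by (simp add: k_def)
  have "\<exists>P Q R. smooth_on {-e'<..<e'} P \<and> smooth_on {-e'<..<e'} Q \<and> smooth_on (square e') R \<and>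
      (\<forall>u v. (u, v) \<in> square e' \<longrightarrow> k i (u, v) = u\<^sup>2 * P u + v\<^sup>2 * Q v + u\<^sup>2 * v\<^sup>2 * R (u, v))" for i
    using axis_critical_decomposition[OF k N(1) k0 kcrit, of i] by metis
  then obtain P Q R where P: "\<And>i. smooth_on {-e'<..<e'} (P i)" and Q: "\<And>i. smooth_on {-e'<..<e'} (Q i)"
    and R: "\<And>i. smooth_on (square e') (R i)"
    and kdec: "\<And>i u v. (u, v) \<in> square e' \<Longrightarrow> k i (u, v) = u\<^sup>2 * P i u + v\<^sup>2 * Q i v + u\<^sup>2 * v\<^sup>2 * R i (u, v)"
    by metis
  \<comment> \<open>On the axes \<open>s\<close> is a substitution by u * sqrt(p 1 u) or v * sqrt(-
    q 1 v), so old and new coefficients differ by the factor \<open>p 1 0\<close> or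
    \<open>- q 1 0\<close>.\<close>
  have coeffs: "p 1 0 * P i 0 = p i 0" "- q 1 0 * Q i 0 = q i 0" for i
  proof -
    note cont = continuous_on_subset[OF smooth_on_continuous de]
    show "p 1 0 * P i 0 = p i 0"
    proof (rule quadratic_coefficient_rescale[OF d(1) cont[OF p] cont[OF p] smooth_on_continuous[OF P]])
      fix u assume "\<bar>u\<bar> < d"
      note u = dU[OF this]
      have s: "s (u, 0) = (u * sqrt (p 1 u), 0)" "p 1 u > 0" using N(6)[OF u(1)] by auto
      then have sq: "(u * sqrt (p 1 u), 0) \<in> square e'" using sU[OF u(1)] by simp
      have "k i (u * sqrt (p 1 u), 0) = F i (u, 0)" using ks[OF u(1)] s by simp
      also have "\<dots> = u\<^sup>2 * p i u" using dec[of u 0 i] u(3) e by (simp add: in_square_iff)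
      finally show "p 1 u > 0 \<and> \<bar>u * sqrt (p 1 u)\<bar> < e' \<and>
          (u * sqrt (p 1 u))\<^sup>2 * P i (u * sqrt (p 1 u)) = u\<^sup>2 * p i u"
        using kdec[OF sq, of i] sq s(2) by (simp add: in_square_iff)
    qed
    have "continuous_on {-d<..<d} (\<lambda>v. - q 1 v)" by (intro continuous_intros cont[OF q])
    then show "- q 1 0 * Q i 0 = q i 0"
    proof (rule quadratic_coefficient_rescale[OF d(1) _ cont[OF q] smooth_on_continuous[OF Q]])
      fix v assume "\<bar>v\<bar> < d"
      note v = dU[OF this]
      have s: "s (0, v) = (0, v * sqrt (- q 1 v))" "q 1 v < 0" using N(7)[OF v(2)] by auto
      then have sq: "(0, v * sqrt (- q 1 v)) \<in> square e'" using sU[OF v(2)] by simp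
      have "k i (0, v * sqrt (- q 1 v)) = F i (0, v)" using ks[OF v(2)] s by simp
      also have "\<dots> = v\<^sup>2 * q i v" using dec[of 0 v i] v(3) e by (simp add: in_square_iff)
      finally show "- q 1 v > 0 \<and> \<bar>v * sqrt (- q 1 v)\<bar> < e' \<and>
          (v * sqrt (- q 1 v))\<^sup>2 * Q i (v * sqrt (- q 1 v)) = v\<^sup>2 * q i v"
        using kdec[OF sq, of i] sq s(2) by (simp add: in_square_iff)
    qed
  qed
  \<comment> \<open>For the second component the quotients are (\<alpha> a/2)/(\<alpha>/2) and
    (\<beta> a/2)/(\<beta>/2); this is where the two become equal.\<close>
  have 2: "P 2 0 = a" "Q 2 0 = a" and 3: "P 3 0 = 0" "Q 3 0 = 0"
    using coeffs[of 2] coeffs[of 3] pv qv A(3,4) by auto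
  obtain b1 b2 b3 where b: "smooth_germ0 b1" "smooth_germ0 b2" "smooth_germ0 b3"
    "\<And>u v. (u, v) \<in> square e' \<Longrightarrow> k 2 (u, v) = a * (u\<^sup>2 + v\<^sup>2) + u^3 * b1 u + u\<^sup>2 * v\<^sup>2 * b2 (u, v) + v^3 * b3 v"
    using split_quadratic_coefficients[OF N(1) P Q R kdec 2] by blast
  obtain c1 c2 c3 where c: "smooth_germ0 c1" "smooth_germ0 c2" "smooth_germ0 c3"
    "\<And>u v. (u, v) \<in> square e' \<Longrightarrow> k 3 (u, v) = 0 * (u\<^sup>2 + v\<^sup>2) + u^3 * c1 u + u\<^sup>2 * v\<^sup>2 * c2 (u, v) + v^3 * c3 v"
    using split_quadratic_coefficients[OF N(1) P Q R kdec 3] by blast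
  show thesis
  proof (rule that[OF b(1,3) c(1,3) b(2) c(2) N(2,3) A(1,2)])
    fix u v assume uv: "(u, v) \<in> square e'"
    have "k 1 (u, v) = u\<^sup>2 - v\<^sup>2"
      using N(4)[OF tU[OF uv]] st[OF uv] by (simp add: k_def)
    then show "A *v g (t (u,v)) =
         vector [u^2 - v^2,
                 a * (u^2 + v^2) + u^3 * b1 u + u^2 * v^2 * b2 (u,v) + v^3 * b3 v,
                 u^3 * c1 u + u^2 * v^2 * c2 (u,v) + v^3 * c3 v]"
      using b(4)[OF uv] c(4)[OF uv] by (simp add: vec_eq_iff forall_3 k_def F_def)
  qed
qed

theorem theorem1:
  fixes f :: "real \<times> real \<Rightarrow> real^3"
  assumes f_smooth: "smooth_germ0 f"
    and f0: "f 0 = 0"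
    and coords: "\<exists>U V \<kappa> \<kappa>i \<phi>1 \<phi>2 W. diffeo0 U V \<kappa> \<kappa>i \<and>
        smooth_germ0 (\<phi>1 :: real \<times> real \<Rightarrow> real^3) \<and> smooth_germ0 (\<phi>2 :: real \<times> real \<Rightarrow> real^3) \<and>
        open W \<and> 0 \<in> W \<and> W \<subseteq> V \<and>
        (\<forall>(u,v)\<in>W. partial_u (f \<circ> \<kappa>i) (u,v) = u *\<^sub>R \<phi>1 (u,v) \<and>
                    partial_v (f \<circ> \<kappa>i) (u,v) = v *\<^sub>R \<phi>2 (u,v)) \<and>
        (\<forall>\<alpha> \<beta>::real. \<alpha> *\<^sub>R \<phi>1 (0,0) + \<beta> *\<^sub>R \<phi>2 (0,0) = 0 \<longrightarrow> \<alpha> = 0 \<and> \<beta> = 0)"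
  shows "\<exists>(a::real) (b1::real\<Rightarrow>real) (b3::real\<Rightarrow>real) (c1::real\<Rightarrow>real) (c3::real\<Rightarrow>real)
           (b2::real\<times>real\<Rightarrow>real) (c2::real\<times>real\<Rightarrow>real) U V s t (A::real^3^3).
      smooth_germ0 b1 \<and> smooth_germ0 b3 \<and> smooth_germ0 c1 \<and> smooth_germ0 c3 \<and>
      smooth_germ0 b2 \<and> smooth_germ0 c2 \<and>
      diffeo0 U V s t \<and> (\<forall>x\<in>U. jac_det s x > 0) \<and> A \<in> SO3 \<and>
      (\<forall>(u,v)\<in>V. A *v f (t (u,v)) =
         vector [u^2 - v^2,
                 a * (u^2 + v^2) + u^3 * b1 u + u^2 * v^2 * b2 (u,v) + v^3 * b3 v,
                 u^3 * c1 u + u^2 * v^2 * c2 (u,v) + v^3 * c3 v]) \<and>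
      a \<ge> 0 \<and> c1 0 \<ge> 0 \<and> c3 0 \<ge> 0"
proof -
  obtain U V \<kappa> \<kappa>i \<phi>1 \<phi>2 W where K: "diffeo0 U V \<kappa> \<kappa>i"
    and \<phi>: "smooth_germ0 (\<phi>1 :: real \<times> real \<Rightarrow> real^3)" "smooth_germ0 (\<phi>2 :: real \<times> real \<Rightarrow> real^3)"
    and W: "open W" "0 \<in> W" "W \<subseteq> V"
    and par0: "\<forall>(u,v)\<in>W. partial_u (f \<circ> \<kappa>i) (u,v) = u *\<^sub>R \<phi>1 (u,v) \<and>
                    partial_v (f \<circ> \<kappa>i) (u,v) = v *\<^sub>R \<phi>2 (u,v)"
    and indep0: "\<forall>\<alpha> \<beta>::real. \<alpha> *\<^sub>R \<phi>1 (0,0) + \<beta> *\<^sub>R \<phi>2 (0,0) = 0 \<longrightarrow> \<alpha> = 0 \<and> \<beta> = 0"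
    using coords by (elim exE conjE) (rule that)
  have par: "partial_u (\<lambda>x. f (\<kappa>i x)) (u,v) = u *\<^sub>R \<phi>1 (u,v)"
    "partial_v (\<lambda>x. f (\<kappa>i x)) (u,v) = v *\<^sub>R \<phi>2 (u,v)" if "(u, v) \<in> W" for u v
    using bspec[OF par0 that] by (simp_all add: comp_def)
  have indep: "\<alpha> = 0 \<and> \<beta> = 0" if "\<alpha> *\<^sub>R \<phi>1 (0,0) + \<beta> *\<^sub>R \<phi>2 (0,0) = 0" for \<alpha> \<beta>
    using indep0 that by blast
  obtain \<Phi>1 where \<Phi>1: "open \<Phi>1" "0 \<in> \<Phi>1" "smooth_on \<Phi>1 \<phi>1" using \<phi>(1) by (auto simp: smooth_germ0_def)
  obtain \<Phi>2 where \<Phi>2: "open \<Phi>2" "0 \<in> \<Phi>2" "smooth_on \<Phi>2 \<phi>2" using \<phi>(2) by (auto simp: smooth_germ0_def)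
  obtain Y where Y: "open Y" "0 \<in> Y" "smooth_on Y f" using f_smooth by (auto simp: smooth_germ0_def)
  have V: "open V" "0 \<in> V" "smooth_on V \<kappa>i" "\<kappa>i 0 = 0"
    using diffeo0_sym[OF K] by (auto simp: diffeo0_def)
  \<comment> \<open>The given coordinates may leave the region where \<open>f\<close> is known to be
    smooth, so their domain is restricted first.\<close>
  define X where "X = V \<inter> \<kappa>i -` Y"
  have X: "open X" "0 \<in> X"
    unfolding X_def using continuous_open_preimage[OF smooth_on_continuous[OF V(3)] V(1) Y(1)] V Y by auto
  have gX: "smooth_on X (\<lambda>x. f (\<kappa>i x))"
    by (rule smooth_on_compose[OF X(1) smooth_on_subset[OF V(3)] Y(3)]) (auto simp: X_def)
  obtain e where e: "e > 0" "square e \<subseteq> X \<inter> W \<inter> \<Phi>1 \<inter> \<Phi>2"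
    by (rule open_contains_square[of "X \<inter> W \<inter> \<Phi>1 \<inter> \<Phi>2"]) (use X W \<Phi>1 \<Phi>2 in auto)
  have g: "smooth_on (square e) (\<lambda>x. f (\<kappa>i x))" using gX e(2) by (auto intro: smooth_on_subset)
  have c: "continuous_on (square e) \<phi>1" "continuous_on (square e) \<phi>2"
    using \<Phi>1(3) \<Phi>2(3) e(2) by (auto intro!: smooth_on_continuous intro: smooth_on_subset)
  have g0: "f (\<kappa>i 0) = 0" using V(4) f0 by simp
  have pe: "\<And>u v. (u, v) \<in> square e \<Longrightarrow> partial_u (\<lambda>x. f (\<kappa>i x)) (u,v) = u *\<^sub>R \<phi>1 (u,v)"
      "\<And>u v. (u, v) \<in> square e \<Longrightarrow> partial_v (\<lambda>x. f (\<kappa>i x)) (u,v) = v *\<^sub>R \<phi>2 (u,v)"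
    using par e(2) by blast+
  obtain a b1 b2 b3 c1 c2 c3 U' V' s t A where N:
    "smooth_germ0 b1" "smooth_germ0 b3" "smooth_germ0 c1" "smooth_germ0 c3" "smooth_germ0 b2" "smooth_germ0 c2"
    "U' \<subseteq> square e" "diffeo0 U' V' s t" "A \<in> SO3" "a \<ge> 0"
    "\<And>u v. (u, v) \<in> V' \<Longrightarrow> A *v f (\<kappa>i (t (u,v))) =
         vector [u^2 - v^2,
                 a * (u^2 + v^2) + u^3 * b1 u + u^2 * v^2 * b2 (u,v) + v^3 * b3 v,
                 u^3 * c1 u + u^2 * v^2 * c2 (u,v) + v^3 * c3 v]"
    by (rule axis_critical_normal_form[OF e(1) g g0 c pe indep]) (assumption | rule that)+
  have "open U'" "0 \<in> U'" "U' \<subseteq> V" using N(7,8) e(2) W(3) by (auto simp: diffeo0_def)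
  \<comment> \<open>The domain of the given coordinates is shrunk to match the source of
    \<open>s\<close>, so that the two diffeomorphisms compose.\<close>
  then have "diffeo0 (\<kappa>i ` U') U' \<kappa> \<kappa>i" using diffeo0_restrict_range[OF K] by blast
  from diffeo0_compose[OF this N(8)]
  have D: "diffeo0 (\<kappa>i ` U') V' (\<lambda>x. s (\<kappa> x)) (\<lambda>y. \<kappa>i (t y))" .
  then have "0 \<in> \<kappa>i ` U'" by (auto simp: diffeo0_def)
  with D have j: "jac_det (\<lambda>x. s (\<kappa> x)) 0 \<noteq> 0" by (rule diffeo0_jac_det_nonzero)
  have "normal_form f a (c1 0) (c3 0) (jac_det (\<lambda>x. s (\<kappa> x)) 0)"
    by (rule normal_formI[OF N(1-6) D N(9,11)]) simp_all
  then obtain \<delta>1 \<delta>3 \<epsilon> where nf: "normal_form f a \<delta>1 \<delta>3 \<epsilon>" "\<delta>1 \<ge> 0" "\<delta>3 \<ge> 0" "\<epsilon> > 0"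
    using normal_form_nonneg_oriented j by blast
  then obtain b1 b3 c1 c3 b2 c2 U V s t A where H:
    "smooth_germ0 b1" "smooth_germ0 b3" "smooth_germ0 c1" "smooth_germ0 c3"
    "smooth_germ0 b2" "smooth_germ0 c2" and D: "diffeo0 U V s t" and A: "A \<in> SO3"
    and eq: "\<And>u v. (u, v) \<in> V \<Longrightarrow> A *v f (t (u,v)) =
         vector [u^2 - v^2,
                 a * (u^2 + v^2) + u^3 * b1 u + u^2 * v^2 * b2 (u,v) + v^3 * b3 v,
                 u^3 * c1 u + u^2 * v^2 * c2 (u,v) + v^3 * c3 v]"
    and v: "c1 0 = \<delta>1" "c3 0 = \<delta>3" "jac_det s 0 = \<epsilon>"
    unfolding normal_form_def by blast
  have U: "open U" "0 \<in> U" "smooth_on U s" "s ` U = V" using D by (auto simp: diffeo0_def)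
  \<comment> \<open>The Jacobian determinant is known to be positive only at 0; continuity gives a
    neighbourhood on which it stays positive.\<close>
  define U' where "U' = U \<inter> jac_det s -` {0<..}"
  have "open U'"
    unfolding U'_def
    by (rule continuous_open_preimage[OF smooth_on_continuous[OF smooth_on_jac_det[OF U(1,3)]] U(1)]) auto
  moreover have "U' \<subseteq> U" "0 \<in> U'" using U v nf by (auto simp: U'_def)
  ultimately have D': "diffeo0 U' (s ` U') s t" using diffeo0_restrict[OF D] by blast
  have "s ` U' \<subseteq> V" using U(4) \<open>U' \<subseteq> U\<close> by blast
  then have "\<forall>(u,v)\<in>s ` U'. A *v f (t (u,v)) =
         vector [u^2 - v^2,
                 a * (u^2 + v^2) + u^3 * b1 u + u^2 * v^2 * b2 (u,v) + v^3 * b3 v,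
                 u^3 * c1 u + u^2 * v^2 * c2 (u,v) + v^3 * c3 v]"
    using eq by blast
  moreover have "\<forall>x\<in>U'. jac_det s x > 0" by (simp add: U'_def)
  moreover have "c1 0 \<ge> 0" "c3 0 \<ge> 0" using v nf by simp_all
  ultimately show ?thesis using H D' A N(10) by blast
qed

end
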